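(* Let $\mathcal{X}$ be a Polish space, $\gamma$ a (reference) measure on $\mathcal{X}$ and $I:\mathcal{X}\to[0,\infty]$ a rate function that is continuous on its domain of finiteness, in the sense that $I$, as a function from $\mathcal{X}$ to $[0,\infty]$, is continuous at every point $x$ with $I(x)<\infty$. Suppose that for every $\varepsilon\in(0,\infty)$ the probability measure $\mu^\varepsilon$ on $\mathcal{X}$ has the form $\mu^\varepsilon(dx)=\frac{1}{Z^\varepsilon}e^{-\frac1\varepsilon I(x)}\gamma(dx)$, and that $\{\mu^\varepsilon\}$ satisfies the large deviation principle as $\varepsilon\to0$ with rate function $I$ and scaling $\varepsilon$. Let $A\subset\mathcal{X}$ be the closure of its interior, and write $I(A)=\inf_{x\in A}I(x)$. Then for every integer $K\ge1$ and every $\boldsymbol{\alpha}=(\alpha_1,\dots,\alpha_K)$ with $1=\alpha_1\ge\cdots\ge\alpha_K>0$, $$\lim_{\varepsilon\to0}-\varepsilon\log E\left[\left(\hat\theta^\varepsilon(\mathbf{X}^\varepsilon;\boldsymbol{\alpha})\right)^2\right]=V(\boldsymbol{\alpha})\cdot I(A),$$ where $\hat\theta^\varepsilon$ is the $K$-temperature INS estimator of $\mu^\varepsilon(A)$ defined in the context and $$V(\boldsymbol{\alpha})=\inf\left\{2\sum_{j=1}^K\alpha_jI_j-\min_{\sigma\in\Sigma_K}\sum_{j=1}^K\alpha_jI_{\sigma(j)}\ :\ I_1=1,\ I_j\in[0,1]\text{ for }j=2,\dots,K\right\}.$$ Moreover, over all $\boldsymbol{\alpha}$ with $1=\alpha_1\ge\cdots\ge\alpha_K\ge0$,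 $V(\boldsymbol{\alpha})$ achieves its maximal value of $2-(1/2)^{K-1}$ at $\boldsymbol{\alpha}^*=(1,1/2,\dots,1/2^{K-1})$.
   Context: A rate function is a map $I:\mathcal{X}\to[0,\infty]$ with $\{I\le M\}$ compact for every $M\in[0,\infty)$. $\{\mu^\varepsilon\}$ satisfies the large deviation principle (LDP) with rate function $I$ and scaling $\varepsilon$ if $\limsup_{\varepsilon\to0}\varepsilon\log\mu^\varepsilon(C)\le-\inf_C I$ for every closed $C$ and $\liminf_{\varepsilon\to0}\varepsilon\log\mu^\varepsilon(O)\ge-\inf_O I$ for every open $O$. $Z^\varepsilon=\int e^{-I/\varepsilon}d\gamma\in(0,\infty)$ is the normalizing constant. Conventions: $\inf\emptyset=+\infty$, $-\log 0=+\infty$. $\Sigma_K$ is the set of permutations of $\{1,\dots,K\}$. For $\mathbf{x}=(x_1,\dots,x_K)\in\mathcal{X}^K$ define $$\rho^\varepsilon(\mathbf{x};\boldsymbol{\alpha})=\frac{e^{-\frac1\varepsilon\sum_{j=1}^K\alpha_jI(x_j)}}{\sum_{\tau\in\Sigma_K}e^{-\frac1\varepsilon\sum_{j=1}^K\alpha_jI(x_{\tau(j)})}}$$ ($e^{-\infty}=0$; the value when the denominator vanishes is irrelevant, say $0$, since this occurs with probability $0$ below). Let $X_1^\varepsilon,\dots,X_K^\varepsilon$ be independent with $X_j^\varepsilon\sim\mu^{\varepsilon/\alpha_j}$, $\mathbf{X}^\varepsilon=(X_1^\varepsilon,\dots,X_K^\varepsilon)$ and $\mathbf{X}^\varepsilon_\sigma=(X^\varepsilon_{\sigma(1)},\dots,X^\varepsilon_{\sigma(K)})$.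 The $K$-temperature INS estimator of $\mu^\varepsilon(A)$ is $$\hat\theta^\varepsilon(\mathbf{X}^\varepsilon;\boldsymbol{\alpha})=\sum_{\sigma\in\Sigma_K}\rho^\varepsilon(\mathbf{X}^\varepsilon_\sigma;\boldsymbol{\alpha})\,1_A(X^\varepsilon_{\sigma(1)}).$$ *)

theory Defs
  imports "HOL-Probability.Probability" "HOL-Combinatorics.Permutations"
begin

definition rate_function :: "('a::topological_space \<Rightarrow> ennreal) \<Rightarrow> bool" where
  "rate_function I \<longleftrightarrow> (\<forall>M::real. 0 \<le> M \<longrightarrow> compact {x. I x \<le> ennreal M})"

text \<open>Logarithm of a nonnegative real, with \<open>log 0 = -\<infinity>\<close>.\<close>
definition elog :: "real \<Rightarrow> ereal" where
  "elog p = (if p \<le> 0 then -\<infinity> else ereal (ln p))"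

text \<open>\<open>e\<^sup>-\<^sup>t\<close> for \<open>t \<in> [0,\<infinity>]\<close>, with \<open>e\<^sup>-\<^sup>\<infinity> = 0\<close>.\<close>
definition exp_neg :: "ennreal \<Rightarrow> real" where
  "exp_neg t = (if t = \<infinity> then 0 else exp (- enn2real t))"

definition satisfies_LDP ::
  "(real \<Rightarrow> 'a::topological_space measure) \<Rightarrow> ('a \<Rightarrow> ennreal) \<Rightarrow> bool" where
  "satisfies_LDP \<mu> I \<longleftrightarrow>
     (\<forall>C. closed C \<longrightarrow>
        Limsup (at_right 0) (\<lambda>\<epsilon>. ereal \<epsilon> * elog (measure (\<mu> \<epsilon>) C))
          \<le> - enn2ereal (INF x\<in>C. I x)) \<and>
     (\<forall>G. open G \<longrightarrow>
        - enn2ereal (INF x\<in>G. I x)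
          \<le> Liminf (at_right 0) (\<lambda>\<epsilon>. ereal \<epsilon> * elog (measure (\<mu> \<epsilon>) G)))"

definition gibbs_Z :: "'a measure \<Rightarrow> ('a \<Rightarrow> ennreal) \<Rightarrow> real \<Rightarrow> ennreal" where
  "gibbs_Z \<gamma> I \<epsilon> = (\<integral>\<^sup>+x. ennreal (exp_neg (I x / ennreal \<epsilon>)) \<partial>\<gamma>)"

definition gibbs_measure :: "'a measure \<Rightarrow> ('a \<Rightarrow> ennreal) \<Rightarrow> real \<Rightarrow> 'a measure" where
  "gibbs_measure \<gamma> I \<epsilon> =
     density \<gamma> (\<lambda>x. ennreal (exp_neg (I x / ennreal \<epsilon>)) / gibbs_Z \<gamma> I \<epsilon>)"

text \<open>
  A \<open>K\<close>-tuple is a function on \<open>nat\<close> of which only the values on \<open>{1..K}\<close> matter.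
\<close>

definition weighted_energy :: "('a \<Rightarrow> ennreal) \<Rightarrow> nat \<Rightarrow> (nat \<Rightarrow> real) \<Rightarrow> (nat \<Rightarrow> 'a) \<Rightarrow> ennreal" where
  "weighted_energy I K \<alpha> x = (\<Sum>j=1..K. ennreal (\<alpha> j) * I (x j))"

text \<open>If the denominator vanishes, the value is \<open>0\<close> because \<open>0 / 0 = 0\<close>.\<close>
definition INS_rho ::
  "('a \<Rightarrow> ennreal) \<Rightarrow> nat \<Rightarrow> (nat \<Rightarrow> real) \<Rightarrow> real \<Rightarrow> (nat \<Rightarrow> 'a) \<Rightarrow> real" where
  "INS_rho I K \<alpha> \<epsilon> x =
     exp_neg (weighted_energy I K \<alpha> x / ennreal \<epsilon>) /
     (\<Sum>\<tau> | \<tau> permutes {1..K}. exp_neg (weighted_energy I K \<alpha> (\<lambda>j. x (\<tau> j)) / ennreal \<epsilon>))"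

definition INS_estimator ::
  "('a \<Rightarrow> ennreal) \<Rightarrow> 'a set \<Rightarrow> nat \<Rightarrow> (nat \<Rightarrow> real) \<Rightarrow> real \<Rightarrow> (nat \<Rightarrow> 'a) \<Rightarrow> real" where
  "INS_estimator I A K \<alpha> \<epsilon> x =
     (\<Sum>\<sigma> | \<sigma> permutes {1..K}. INS_rho I K \<alpha> \<epsilon> (\<lambda>j. x (\<sigma> j)) * indicator A (x (\<sigma> 1)))"

text \<open>Independent \<open>X\<^sub>1, \<dots>, X\<^sub>K\<close> on \<open>P\<close> with \<open>X\<^sub>j\<close> distributed according to \<open>\<mu> (\<epsilon> / \<alpha> j)\<close>.\<close>
definition INS_sample ::
  "(real \<Rightarrow> 'a::topological_space measure) \<Rightarrow> nat \<Rightarrow> (nat \<Rightarrow> real) \<Rightarrow> real \<Rightarrow>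
   'b measure \<Rightarrow> (nat \<Rightarrow> 'b \<Rightarrow> 'a) \<Rightarrow> bool" where
  "INS_sample \<mu> K \<alpha> \<epsilon> P X \<longleftrightarrow>
     prob_space P \<and>
     prob_space.indep_vars P (\<lambda>_. borel) X {1..K} \<and>
     (\<forall>j\<in>{1..K}. distr P borel (X j) = \<mu> (\<epsilon> / \<alpha> j))"

definition INS_weights :: "nat \<Rightarrow> (nat \<Rightarrow> real) \<Rightarrow> bool" where
  "INS_weights K \<alpha> \<longleftrightarrow>
     \<alpha> 1 = 1 \<and> (\<forall>i\<in>{1..K}. \<forall>j\<in>{1..K}. i \<le> j \<longrightarrow> \<alpha> j \<le> \<alpha> i) \<and> (\<forall>j\<in>{1..K}. 0 \<le> \<alpha> j)"

text \<open>
  The infimum ranges over a nonempty set of reals that is bounded below, so \<open>Inf\<close> on \<open>real\<close>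
  is the true infimum.
\<close>
definition INS_V :: "nat \<Rightarrow> (nat \<Rightarrow> real) \<Rightarrow> real" where
  "INS_V K \<alpha> =
     Inf {2 * (\<Sum>j=1..K. \<alpha> j * u j) -
            (MIN \<sigma>\<in>{\<sigma>. \<sigma> permutes {1..K}}. \<Sum>j=1..K. \<alpha> j * u (\<sigma> j))
          | u. u 1 = 1 \<and> (\<forall>j\<in>{2..K}. 0 \<le> u j \<and> u j \<le> 1)}"

end

theory Submission
  imports Defs
begin

text \<open>
  Write \<open>\<langle>\<alpha>, u\<rangle>\<close> for \<open>\<Sum>\<^sub>j \<alpha>\<^sub>j u\<^sub>j\<close> and \<open>F(u) = 2\<langle>\<alpha>, u\<rangle> - min\<^sub>\<sigma> \<langle>\<alpha>, u \<circ> \<sigma>\<rangle>\<close>. Splitting a nonnegative \<open>u\<close> into its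
  layers shows \<open>F(u) \<ge> V(\<alpha>) u\<^sub>1\<close>, and \<open>V(\<alpha>) = min\<^sub>m (2 - \<alpha>\<^sub>m + \<Sum>\<^sub>j\<^sub>>\<^sub>m \<alpha>\<^sub>j)\<close> is attained at the vectors
  \<open>(1, 0, \<dots>, 0, 1, \<dots>, 1)\<close>. Only the energy levels \<open>0\<close> and \<open>I(A)\<close> are thus needed for the lower bound of the
  second moment, and these are reached on open sets, which have positive \<open>\<gamma>\<close>-measure by the large deviation
  principle.

  For the upper bound no partition of the energy range is necessary: with \<open>u\<^sub>j = I(X\<^sub>j)\<close>, each weight satisfies
  \<open>\<rho>(X\<^sub>\<sigma>)\<^sup>2 \<le> exp(-(F(u \<circ> \<sigma>) - \<langle>\<alpha>, u\<rangle>)/\<epsilon>)\<close>. The term \<open>F\<close> is replaced by a convex combination of its two lower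
  bounds \<open>V(\<alpha>) I(A)\<close> and \<open>\<alpha>\<^sub>K \<Sum>\<^sub>j u\<^sub>j\<close>; the latter, however small its share, makes the remaining product of
  exponentials integrable, with integral a product of ratios of normalizing constants. These are
  subexponential in \<open>1/\<epsilon>\<close>.
\<close>

subsection \<open>The variational problem\<close>

text \<open>An exchange argument: \<open>S\<close> and the final segment have equal size, so their
  differences have equal size too, and \<open>\<alpha> i\<close> separates the weights, being at
  least those inside the segment and at most those before it.\<close>

lemma sum_final_segment_le:
  fixes \<alpha> :: "nat \<Rightarrow> real"
  assumes anti: "\<And>i j. 1 \<le> i \<Longrightarrow> i \<le> j \<Longrightarrow> j \<le> K \<Longrightarrow> \<alpha> j \<le> \<alpha> i"
    and S: "S \<subseteq> {1..K}" "card S = K - i"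
  shows "sum \<alpha> {Suc i..K} \<le> sum \<alpha> S"
\<comment> \<open>At \<open>i = 0\<close> there is no separating weight, since
  \<open>\<alpha> 0\<close> is unconstrained; both index sets are then all of \<open>{1..K}\<close>.
  For \<open>i \<ge> K\<close> both are empty.\<close>
proof (cases "i = 0 \<or> i \<ge> K")
  case True
  then show ?thesis
  proof
    assume "i = 0"
    then have "S = {1..K}"
      using S by (intro card_subset_eq) auto
    then show ?thesis using \<open>i = 0\<close> by simp
  next
    assume "i \<ge> K"
    then have "S = {}"
      using S finite_subset[OF S(1)] by auto
    then show ?thesis using \<open>i \<ge> K\<close> by simp
  qed
next
  case False
  let ?T = "{Suc i..K}"
  have fin: "finite S" using S finite_subset by blast
  have card: "card (S - ?T) = card (?T - S)"
  proof -
    have "card S = card (S \<inter> ?T) + card (S - ?T)" "card ?T = card (S \<inter> ?T) + card (?T - S)"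
      using fin card_Int_Diff[of S ?T] card_Int_Diff[of ?T S] by (auto simp: Int_commute)
    then show ?thesis using S by simp
  qed
  have "sum \<alpha> (?T - S) \<le> (\<Sum>j\<in>?T - S. \<alpha> i)"
    using anti[of i] False by (intro sum_mono) auto
  also have "\<dots> = (\<Sum>j\<in>S - ?T. \<alpha> i)"
    by (simp add: card)
  also have "\<dots> \<le> sum \<alpha> (S - ?T)"
    using anti[of _ i] False S by (intro sum_mono) auto
  finally have "sum \<alpha> (?T - S) \<le> sum \<alpha> (S - ?T)" .
  then show ?thesis
    using sum.Int_Diff[OF fin, of \<alpha> ?T] sum.Int_Diff[of ?T \<alpha> S] by (simp add: Int_commute)
qed

lemma sorting_permutation:
  fixes u :: "nat \<Rightarrow> 'a::linorder"
  obtains \<sigma> where "\<sigma> permutes {1..K}" "\<And>i j. 1 \<le> i \<Longrightarrow> i \<le> j \<Longrightarrow> j \<le> K \<Longrightarrow> u (\<sigma> i) \<le> u (\<sigma> j)"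
proof -
  define xs where "xs = sort_key u [1..<Suc K]"
  \<comment> \<open>List positions start at 0 and indices at 1, hence the shift; being the identity
    outside \<open>{1..K}\<close> is part of \<open>permutes\<close>.\<close>
  define \<sigma> where "\<sigma> j = (if j \<in> {1..K} then xs ! (j - 1) else j)" for j
  have len: "length xs = K" by (simp add: xs_def)
  have set: "set xs = {1..K}" by (auto simp: xs_def)
  have dist: "distinct xs" by (simp add: xs_def)
  have "inj_on \<sigma> {1..K}"
  proof (rule inj_onI)
    fix i j assume ij: "i \<in> {1..K}" "j \<in> {1..K}" "\<sigma> i = \<sigma> j"
    then have "i - 1 = j - 1"
      using nth_eq_iff_index_eq[OF dist, of "i - 1" "j - 1"] by (auto simp: \<sigma>_def len)
    then show "i = j" using ij by auto
  qed
  moreover have "\<sigma> ` {1..K} \<subseteq> {1..K}"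
  proof
    fix y assume "y \<in> \<sigma> ` {1..K}"
    then obtain j where "j \<in> {1..K}" "y = xs ! (j - 1)" by (auto simp: \<sigma>_def)
    then have "y \<in> set xs" by (auto simp: len intro!: nth_mem)
    then show "y \<in> {1..K}" using set by simp
  qed
  ultimately have "bij_betw \<sigma> {1..K} {1..K}"
    unfolding bij_betw_def by (intro conjI endo_inj_surj) auto
  then have "\<sigma> permutes {1..K}"
    by (rule bij_imp_permutes) (auto simp: \<sigma>_def)
  moreover have "u (\<sigma> i) \<le> u (\<sigma> j)" if "1 \<le> i" "i \<le> j" "j \<le> K" for i j
  proof -
    have "sorted (map u xs)" by (simp add: xs_def)
    then have "map u xs ! (i - 1) \<le> map u xs ! (j - 1)"
      using that by (intro sorted_nth_mono) (auto simp: len)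
    then show ?thesis using that by (auto simp: \<sigma>_def len)
  qed
  ultimately show thesis by (rule that)
qed

text \<open>The minimum occurring in \<open>INS_V\<close>. When \<open>u\<close> holds the energies
  of a sample, it is also the exponent of the dominant term in the denominator of
  \<open>INS_rho\<close>.\<close>

definition least_energy :: "nat \<Rightarrow> (nat \<Rightarrow> real) \<Rightarrow> (nat \<Rightarrow> real) \<Rightarrow> real" where
  "least_energy K \<alpha> u = (MIN \<sigma>\<in>{\<sigma>. \<sigma> permutes {1..K}}. \<Sum>j=1..K. \<alpha> j * u (\<sigma> j))"

lemma least_energy_le:
  assumes "\<sigma> permutes {1..K}"
  shows "least_energy K \<alpha> u \<le> (\<Sum>j=1..K. \<alpha> j * u (\<sigma> j))"
  unfolding least_energy_def using assms by (intro Min_le) (auto simp: finite_permutations)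

lemma least_energy_attained:
  obtains \<sigma> where "\<sigma> permutes {1..K}" "least_energy K \<alpha> u = (\<Sum>j=1..K. \<alpha> j * u (\<sigma> j))"
proof -
  have "least_energy K \<alpha> u \<in> (\<lambda>\<sigma>. \<Sum>j=1..K. \<alpha> j * u (\<sigma> j)) ` {\<sigma>. \<sigma> permutes {1..K}}"
    unfolding least_energy_def using permutes_id[of "{1..K}"] by (intro Min_in) (auto simp: finite_permutations simp del: permutes_id)
  then show thesis using that by auto
qed

lemma least_energy_geI:
  assumes "\<And>\<sigma>. \<sigma> permutes {1..K} \<Longrightarrow> c \<le> (\<Sum>j=1..K. \<alpha> j * u (\<sigma> j))"
  shows "c \<le> least_energy K \<alpha> u"
  using least_energy_attained[of K \<alpha> u] assms by metis

text \<open>The objective of \<open>INS_V\<close> at \<open>step_vector m\<close> in closed form: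
  with \<open>t\<close> the sum of the weights after \<open>m\<close>, it is
  \<open>2 * (1 + t) - (\<alpha> m + t)\<close>.\<close>

definition step_value :: "nat \<Rightarrow> (nat \<Rightarrow> real) \<Rightarrow> nat \<Rightarrow> real" where
  "step_value K \<alpha> m = 2 - \<alpha> m + (\<Sum>j=Suc m..K. \<alpha> j)"

text \<open>The zeros occupy positions 2 to \<open>m\<close>: \<open>m = 1\<close> gives the
  constant vector 1, and \<open>m = K\<close> leaves only the first coordinate at 1.\<close>

definition step_vector :: "nat \<Rightarrow> nat \<Rightarrow> real" where
  "step_vector m j = (if j = 1 \<or> m < j then 1 else 0)"

lemma INS_weightsD:
  assumes "INS_weights K \<alpha>"
  shows "\<alpha> 1 = 1" "\<And>i j. 1 \<le> i \<Longrightarrow> i \<le> j \<Longrightarrow> j \<le> K \<Longrightarrow> \<alpha> j \<le> \<alpha> i"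
    "\<And>j. 1 \<le> j \<Longrightarrow> j \<le> K \<Longrightarrow> 0 \<le> \<alpha> j" "\<And>j. 1 \<le> j \<Longrightarrow> j \<le> K \<Longrightarrow> \<alpha> j \<le> 1"
proof -
  show 1: "\<alpha> 1 = 1" and "\<And>j. 1 \<le> j \<Longrightarrow> j \<le> K \<Longrightarrow> 0 \<le> \<alpha> j"
    using assms by (auto simp: INS_weights_def)
  show 2: "\<alpha> j \<le> \<alpha> i" if "1 \<le> i" "i \<le> j" "j \<le> K" for i j
  proof -
    have "i \<in> {1..K}" "j \<in> {1..K}" using that by auto
    then show ?thesis using assms that(2) unfolding INS_weights_def by blast
  qed
  show "\<alpha> j \<le> 1" if "1 \<le> j" "j \<le> K" for j
    using 2[OF order_refl that] unfolding 1 .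
qed

text \<open>
  Sort \<open>u\<close> by \<open>\<sigma>\<close> and split it into its layers \<open>d i\<close>, carried by the index sets \<open>S i\<close>; the inequality
  then holds layer by layer.
\<close>
lemma step_values_le_energy_gap:
  assumes \<alpha>: "INS_weights K \<alpha>" and K: "1 \<le> K"
    and u: "\<And>j. j \<in> {1..K} \<Longrightarrow> 0 \<le> u j"
    and c: "\<And>m. m \<in> {1..K} \<Longrightarrow> c \<le> step_value K \<alpha> m"
  shows "c * u 1 \<le> 2 * (\<Sum>j=1..K. \<alpha> j * u j) - least_energy K \<alpha> u"
proof -
  note W = INS_weightsD[OF \<alpha>]
  obtain \<sigma> where \<sigma>: "\<sigma> permutes {1..K}"
    and mono: "\<And>i j. 1 \<le> i \<Longrightarrow> i \<le> j \<Longrightarrow> j \<le> K \<Longrightarrow> u (\<sigma> i) \<le> u (\<sigma> j)"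
    by (rule sorting_permutation[where u=u]) blast
  \<comment> \<open>The value 0 at index 0 makes the lowest layer \<open>d 1\<close> equal to the
    smallest energy, so that the increments telescope to \<open>w\<close>.\<close>
  define w where "w i = (if i = 0 then 0 else u (\<sigma> i))" for i
  define d where "d i = w i - w (i - 1)" for i
  define S where "S i = \<sigma> ` {i..K}" for i
  \<comment> \<open>The rank of coordinate 1 in the sorted order: layer \<open>i\<close> contains
    coordinate 1 exactly when \<open>i \<le> p\<close>.\<close>
  define p where "p = inv \<sigma> 1"
  have \<sigma>in: "\<sigma> j \<in> {1..K}" if "j \<in> {1..K}" for j
    using permutes_in_image[OF \<sigma>] that by blast
  have p: "p \<in> {1..K}" "\<sigma> p = 1"
    using permutes_in_image[OF permutes_inv[OF \<sigma>], of 1] permutes_inverses[OF \<sigma>] K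
    by (auto simp: p_def)
  have d0: "0 \<le> d i" if "i \<in> {1..K}" for i
    using mono[of "i - 1" i] u[OF \<sigma>in[OF that]] that by (auto simp: d_def w_def)
  have w_eq: "w n = (\<Sum>i=1..n. d i)" for n
    by (induction n) (auto simp: d_def w_def)
  \<comment> \<open>If \<open>S i\<close> contains 1, that index has weight 1 and the other
    \<open>K - i\<close> indices weigh at least as much as the last \<open>K - i\<close> ones, which
    produces \<open>step_value K \<alpha> i\<close>. Otherwise the left side is 0, and
    \<open>S i\<close> weighs at least as much as the final segment of the same size.\<close>
  have layer: "c * (if i \<le> p then 1 else 0) \<le> 2 * sum \<alpha> (S i) - sum \<alpha> {i..K}"
    if i: "i \<in> {1..K}" for i
  proof -
    have SK: "S i \<subseteq> {1..K}" using i \<sigma>in unfolding S_def by fastforce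
    have inj: "inj_on \<sigma> T" for T
      using permutes_inj[OF \<sigma>] by (rule inj_on_subset) simp
    have cS: "card (S i) = Suc K - i" by (simp add: S_def card_image[OF inj])
    show ?thesis
    proof (cases "i \<le> p")
      case True
      then have 1: "1 \<in> S i" using p by (auto simp: S_def intro!: image_eqI[of _ _ p])
      have fin: "finite (S i)" by (simp add: S_def)
      have "sum \<alpha> {Suc i..K} \<le> sum \<alpha> (S i - {1})"
        using SK cS 1 by (intro sum_final_segment_le W(2)) auto
      then have "1 + sum \<alpha> {Suc i..K} \<le> sum \<alpha> (S i)"
        using sum.remove[OF fin 1, of \<alpha>] W(1) by simp
      moreover have "sum \<alpha> {i..K} = \<alpha> i + sum \<alpha> {Suc i..K}"
        using i by (simp add: sum.atLeast_Suc_atMost)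
      ultimately show ?thesis using c[OF i] True by (simp add: step_value_def)
    next
      case False
      have "sum \<alpha> {Suc (i - 1)..K} \<le> sum \<alpha> (S i)"
        using SK cS i by (intro sum_final_segment_le W(2)) auto
      moreover have "0 \<le> sum \<alpha> {i..K}" using i by (intro sum_nonneg W(3)) auto
      ultimately show ?thesis using False i by simp
    qed
  qed
  have bij: "bij_betw \<sigma> {1..K} {1..K}" by (rule permutes_imp_bij[OF \<sigma>])
  \<comment> \<open>Summation by parts. It is applied to the weights reordered by \<sigma>, whose
    tail sums are the sums of \<alpha> over \<open>S i\<close>, and to \<alpha> itself.\<close>
  have w\<sigma>: "(\<Sum>j=1..K. f j * w j) = (\<Sum>i=1..K. d i * sum f {i..K})" for f :: "nat \<Rightarrow> real"
  proof -
    have "(\<Sum>j=1..K. f j * w j) = (\<Sum>j=1..K. \<Sum>i=1..K. if i \<le> j then f j * d i else 0)"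
    proof (rule sum.cong[OF refl])
      fix j assume j: "j \<in> {1..K}"
      have "f j * w j = (\<Sum>i=1..j. f j * d i)" by (simp add: w_eq sum_distrib_left)
      also have "\<dots> = (\<Sum>i=1..K. if i \<le> j then f j * d i else 0)"
        using j by (intro sum.mono_neutral_cong_left) auto
      finally show "f j * w j = (\<Sum>i=1..K. if i \<le> j then f j * d i else 0)" .
    qed
    also have "\<dots> = (\<Sum>i=1..K. \<Sum>j=1..K. if i \<le> j then f j * d i else 0)"
      by (rule sum.swap)
    also have "\<dots> = (\<Sum>i=1..K. d i * sum f {i..K})"
    proof (rule sum.cong[OF refl])
      fix i assume i: "i \<in> {1..K}"
      have "(\<Sum>j=1..K. if i \<le> j then f j * d i else 0) = (\<Sum>j=i..K. f j * d i)"
        using i by (intro sum.mono_neutral_cong_right) auto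
      then show "(\<Sum>j=1..K. if i \<le> j then f j * d i else 0) = d i * sum f {i..K}"
        by (simp add: sum_distrib_left mult.commute)
    qed
    finally show ?thesis .
  qed
  have "(\<Sum>j=1..K. \<alpha> j * u j) = (\<Sum>j=1..K. \<alpha> (\<sigma> j) * u (\<sigma> j))"
    using sum.reindex_bij_betw[OF bij, of "\<lambda>j. \<alpha> j * u j"] by simp
  also have "\<dots> = (\<Sum>j=1..K. \<alpha> (\<sigma> j) * w j)" by (intro sum.cong) (auto simp: w_def)
  also have "\<dots> = (\<Sum>i=1..K. d i * sum \<alpha> (S i))"
    unfolding w\<sigma>[of "\<lambda>j. \<alpha> (\<sigma> j)"] S_def
    by (intro sum.cong refl arg_cong2[where f="(*)"] sum.reindex[symmetric, unfolded comp_def]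
        inj_on_subset[OF permutes_inj[OF \<sigma>]]) simp
  finally have e1: "(\<Sum>j=1..K. \<alpha> j * u j) = (\<Sum>i=1..K. d i * sum \<alpha> (S i))" .
  \<comment> \<open>The minimum enters the claim with a minus sign, so evaluating it at the sorting
    permutation gives a bound in the right direction.\<close>
  have "least_energy K \<alpha> u \<le> (\<Sum>j=1..K. \<alpha> j * u (\<sigma> j))" by (rule least_energy_le[OF \<sigma>])
  also have "\<dots> = (\<Sum>j=1..K. \<alpha> j * w j)" by (intro sum.cong) (auto simp: w_def)
  also have "\<dots> = (\<Sum>i=1..K. d i * sum \<alpha> {i..K})" by (rule w\<sigma>)
  finally have e2: "least_energy K \<alpha> u \<le> (\<Sum>i=1..K. d i * sum \<alpha> {i..K})" .
  have "c * u 1 = c * w p" using p by (auto simp: w_def)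
  also have "\<dots> = (\<Sum>i=1..K. d i * (c * (if i \<le> p then 1 else 0)))"
    unfolding w_eq sum_distrib_left using p
    by (intro sum.mono_neutral_cong_left) auto
  also have "\<dots> \<le> (\<Sum>i=1..K. d i * (2 * sum \<alpha> (S i) - sum \<alpha> {i..K}))"
    by (intro sum_mono mult_left_mono layer d0)
  also have "\<dots> = 2 * (\<Sum>j=1..K. \<alpha> j * u j) - (\<Sum>i=1..K. d i * sum \<alpha> {i..K})"
    unfolding e1 by (simp add: right_diff_distrib sum_subtractf sum_distrib_left mult_ac)
  finally show ?thesis using e2 by simp
qed

text \<open>Every rearrangement of the step vector places its \<open>K + 1 - m\<close> ones on as
  many positions, and the lightest such set of positions is \<open>{m..K}\<close>.\<close>

lemma step_vector_energy_gap:
  assumes \<alpha>: "INS_weights K \<alpha>" and m: "m \<in> {1..K}"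
  shows "2 * (\<Sum>j=1..K. \<alpha> j * step_vector m j) - least_energy K \<alpha> (step_vector m) \<le> step_value K \<alpha> m"
proof -
  note W = INS_weightsD[OF \<alpha>]
  define S where "S = insert 1 {Suc m..K}"
  have SK: "S \<subseteq> {1..K}" using m by (auto simp: S_def)
  have sv: "step_vector m j = (if j \<in> S then 1 else 0)" if "j \<in> {1..K}" for j
    using that by (auto simp: step_vector_def S_def)
  have cS: "card S = Suc K - m" using m by (auto simp: S_def card_insert_if)
  have "(\<Sum>j=1..K. \<alpha> j * step_vector m j) = sum \<alpha> S"
    using SK sv by (intro sum.mono_neutral_cong_right) auto
  also have "\<dots> = 1 + sum \<alpha> {Suc m..K}" using m W(1) by (simp add: S_def)
  finally have 1: "(\<Sum>j=1..K. \<alpha> j * step_vector m j) = 1 + sum \<alpha> {Suc m..K}" .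
  have "sum \<alpha> {m..K} \<le> least_energy K \<alpha> (step_vector m)"
  proof (rule least_energy_geI)
    fix \<sigma> assume \<sigma>: "\<sigma> permutes {1..K}"
    have in\<sigma>: "\<sigma> j \<in> {1..K} \<longleftrightarrow> j \<in> {1..K}" for j
      by (rule permutes_in_image[OF \<sigma>])
    have "card (\<sigma> -` S) = card S"
      by (rule card_vimage_inj) (use permutes_inj[OF \<sigma>] permutes_surj[OF \<sigma>] in auto)
    moreover have sub: "\<sigma> -` S \<subseteq> {1..K}" using SK in\<sigma> by blast
    ultimately have "sum \<alpha> {Suc (m - 1)..K} \<le> sum \<alpha> (\<sigma> -` S)"
      using m cS by (intro sum_final_segment_le W(2)) auto
    also have "\<dots> = (\<Sum>j=1..K. \<alpha> j * step_vector m (\<sigma> j))"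
      using sub sv in\<sigma> by (intro sum.mono_neutral_cong_left) auto
    finally show "sum \<alpha> {m..K} \<le> (\<Sum>j=1..K. \<alpha> j * step_vector m (\<sigma> j))" using m by simp
  qed
  moreover have "sum \<alpha> {m..K} = \<alpha> m + sum \<alpha> {Suc m..K}"
    using m by (simp add: sum.atLeast_Suc_atMost)
  ultimately show ?thesis using 1 by (simp add: step_value_def)
qed

text \<open>The layer inequality with \<open>u 1 = 1\<close> bounds the objective below by the
  smallest step value, and the corresponding step vector is feasible and reaches it. The infimum is
  thus a minimum over \<open>K\<close> explicit numbers.\<close>

lemma INS_V_eq_Min:
  assumes \<alpha>: "INS_weights K \<alpha>" and K: "1 \<le> K"
  shows "INS_V K \<alpha> = (MIN m\<in>{1..K}. step_value K \<alpha> m)"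
proof -
  define M where "M = (MIN m\<in>{1..K}. step_value K \<alpha> m)"
  define F where "F u = 2 * (\<Sum>j=1..K. \<alpha> j * u j) - least_energy K \<alpha> u" for u
  define U :: "(nat \<Rightarrow> real) set" where "U = {u. u 1 = 1 \<and> (\<forall>j\<in>{2..K}. 0 \<le> u j \<and> u j \<le> 1)}"
  have M: "M \<in> step_value K \<alpha> ` {1..K}" "\<And>m. m \<in> {1..K} \<Longrightarrow> M \<le> step_value K \<alpha> m"
    unfolding M_def using K by (auto intro!: Min_in Min_le)
  have lower: "M \<le> F u" if "u \<in> U" for u
  proof -
    have "0 \<le> u j" if "j \<in> {1..K}" for j
      using that \<open>u \<in> U\<close> by (cases "j = 1") (auto simp: U_def)
    then have "M * u 1 \<le> F u"
      unfolding F_def by (intro step_values_le_energy_gap[OF \<alpha> K] M(2))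
    then show ?thesis using that by (simp add: U_def)
  qed
  obtain m where m: "m \<in> {1..K}" "M = step_value K \<alpha> m" using M(1) by blast
  have sv: "step_vector m \<in> U" by (simp add: step_vector_def U_def)
  moreover have "F (step_vector m) = M"
    using lower[OF sv] step_vector_energy_gap[OF \<alpha> m(1)] m(2) by (simp add: F_def)
  ultimately have "Inf (F ` U) = M"
    using lower by (intro cInf_eq_minimum) auto
  moreover have "INS_V K \<alpha> = Inf (F ` U)"
    unfolding INS_V_def F_def U_def least_energy_def by (rule arg_cong[where f=Inf]) blast
  ultimately show ?thesis by (simp add: M_def)
qed

lemma INS_V_mult_le_energy_gap:
  assumes "INS_weights K \<alpha>" "1 \<le> K" "\<And>j. j \<in> {1..K} \<Longrightarrow> 0 \<le> u j"
  shows "INS_V K \<alpha> * u 1 \<le> 2 * (\<Sum>j=1..K. \<alpha> j * u j) - least_energy K \<alpha> u"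
  unfolding INS_V_eq_Min[OF assms(1,2)]
  by (rule step_values_le_energy_gap[OF assms]) auto

lemma INS_V_attained:
  assumes \<alpha>: "INS_weights K \<alpha>" and K: "1 \<le> K"
  obtains m where "m \<in> {1..K}"
    "2 * (\<Sum>j=1..K. \<alpha> j * step_vector m j) - least_energy K \<alpha> (step_vector m) \<le> INS_V K \<alpha>"
proof -
  have "INS_V K \<alpha> \<in> step_value K \<alpha> ` {1..K}"
    unfolding INS_V_eq_Min[OF assms] using K by (intro Min_in) auto
  then show thesis using that step_vector_energy_gap[OF \<alpha>] by auto
qed

text \<open>Positivity of \<open>INS_V\<close> is what allows a lower bound on an energy to be
  multiplied by it, and what makes the limit infinite when I(A) is infinite.\<close>

lemma INS_V_ge_1:
  assumes \<alpha>: "INS_weights K \<alpha>" and K: "1 \<le> K"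
  shows "1 \<le> INS_V K \<alpha>"
proof -
  note W = INS_weightsD[OF \<alpha>]
  have "1 \<le> step_value K \<alpha> m" if "m \<in> {1..K}" for m
  proof -
    have "0 \<le> (\<Sum>j=Suc m..K. \<alpha> j)" using that by (intro sum_nonneg W(3)) auto
    then show ?thesis using W(4)[of m] that by (simp add: step_value_def)
  qed
  then show ?thesis unfolding INS_V_eq_Min[OF assms] using K by (subst Min_ge_iff) auto
qed

section \<open>The optimal weights\<close>

lemma INS_weights_geometric:
  "INS_weights K (\<lambda>j. (1/2) ^ (j - 1))"
  by (auto simp: INS_weights_def intro!: power_decreasing)

text \<open>For geometric weights all step values coincide: the weights after \<open>m\<close>
  telescope to \<open>\<alpha> m - \<alpha> K\<close>, which cancels \<open>\<alpha> m\<close> and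
  leaves \<open>2 - \<alpha> K\<close>.\<close>

lemma INS_V_geometric:
  assumes K: "1 \<le> K"
  shows "INS_V K (\<lambda>j. (1/2) ^ (j - 1)) = 2 - (1/2) ^ (K - 1)"
proof -
  have "step_value K (\<lambda>j. (1/2) ^ (j - 1)) m = 2 - (1/2) ^ (K - 1)" if "m \<in> {1..K}" for m
  proof -
    have "n \<ge> m \<Longrightarrow> (\<Sum>j=Suc m..n. (1/2::real) ^ (j - 1)) = (1/2) ^ (m - 1) - (1/2) ^ (n - 1)" for n
    proof (induction n rule: dec_induct)
      case (step n)
      then show ?case using that by (cases n) auto
    qed auto
    then show ?thesis using that by (auto simp: step_value_def)
  qed
  then have "step_value K (\<lambda>j. (1/2) ^ (j - 1)) ` {1..K} = {2 - (1/2) ^ (K - 1)}"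
    using K by (auto simp: image_iff)
  then show ?thesis unfolding INS_V_eq_Min[OF INS_weights_geometric K] by (metis Min_singleton)
qed

text \<open>If the bound failed, every step value would exceed 2 - \<delta>, so each weight would be
  less than \<delta> plus the sum of its successors. Working backwards from index \<open>K\<close>,
  the tail sums at most double and gain \<delta> at each step, and at index 1 this contradicts
  \<open>\<alpha> 1 = 1\<close>.\<close>

lemma INS_V_le:
  assumes \<alpha>: "INS_weights K \<alpha>" and K: "1 \<le> K"
  shows "INS_V K \<alpha> \<le> 2 - (1/2) ^ (K - 1)"
proof (rule ccontr)
  assume asm: "\<not> ?thesis"
  define \<delta> :: real where "\<delta> = (1/2) ^ (K - 1)"
  have lt: "\<alpha> m < \<delta> + (\<Sum>j=Suc m..K. \<alpha> j)" if "m \<in> {1..K}" for m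
  proof -
    have "2 - \<delta> < INS_V K \<alpha>" using asm by (simp add: \<delta>_def)
    also have "\<dots> \<le> step_value K \<alpha> m"
      unfolding INS_V_eq_Min[OF assms] using that by (intro Min_le) auto
    finally show ?thesis by (simp add: step_value_def)
  qed
  have tail: "n < K \<Longrightarrow> (\<Sum>j=Suc (K - n)..K. \<alpha> j) \<le> \<delta> * (2 ^ n - 1)" for n
  proof (induction n)
    case (Suc n)
    have eq: "Suc (K - Suc n) = K - n" using Suc.prems by simp
    have "(\<Sum>j=Suc (K - Suc n)..K. \<alpha> j) = \<alpha> (K - n) + (\<Sum>j=Suc (K - n)..K. \<alpha> j)"
      unfolding eq by (rule sum.atLeast_Suc_atMost) simp
    also have "\<dots> \<le> \<delta> + 2 * (\<Sum>j=Suc (K - n)..K. \<alpha> j)"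
    proof -
      have "K - n \<in> {1..K}" using Suc.prems by auto
      from lt[OF this] show ?thesis by simp
    qed
    also have "\<dots> \<le> \<delta> + 2 * (\<delta> * (2 ^ n - 1))" using Suc by simp
    also have "\<dots> = \<delta> * (2 ^ Suc n - 1)" by (simp add: algebra_simps)
    finally show ?case .
  qed simp
  have "1 < \<delta> + (\<Sum>j=Suc (K - (K - 1))..K. \<alpha> j)"
    using lt[of 1] K INS_weightsD(1)[OF \<alpha>] by simp
  also have "\<dots> \<le> \<delta> + \<delta> * (2 ^ (K - 1) - 1)" using tail[of "K - 1"] K by simp
  also have "\<dots> = 1" by (simp add: \<delta>_def field_simps)
  finally show False by simp
qed

subsection \<open>Pointwise bounds on the estimator\<close>

lemma exp_neg_divide:
  assumes "0 < \<epsilon>"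
  shows "exp_neg (t / ennreal \<epsilon>) = (if t = \<infinity> then 0 else exp (- (enn2real t / \<epsilon>)))"
proof (cases t)
  case (real r)
  then show ?thesis using assms by (auto simp: exp_neg_def divide_ennreal)
next
  case top
  then show ?thesis using assms by (simp add: exp_neg_def ennreal_top_divide)
qed

lemma exp_neg_nonneg: "0 \<le> exp_neg t"
  by (simp add: exp_neg_def)

lemma borel_measurable_exp_neg [measurable]: "exp_neg \<in> borel_measurable borel"
  unfolding exp_neg_def[abs_def] by measurable

lemma weighted_energy_finite:
  assumes "\<And>j. j \<in> {1..K} \<Longrightarrow> 0 \<le> \<alpha> j" "\<And>j. j \<in> {1..K} \<Longrightarrow> I (x j) < \<infinity>"
  shows "weighted_energy I K \<alpha> x = ennreal (\<Sum>j=1..K. \<alpha> j * enn2real (I (x j)))"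
proof -
  have "weighted_energy I K \<alpha> x = (\<Sum>j=1..K. ennreal (\<alpha> j * enn2real (I (x j))))"
    unfolding weighted_energy_def using assms by (intro sum.cong) (auto simp: ennreal_mult')
  also have "\<dots> = ennreal (\<Sum>j=1..K. \<alpha> j * enn2real (I (x j)))"
    using assms by (intro sum_ennreal) auto
  finally show ?thesis .
qed

lemma exp_neg_weighted_energy:
  assumes "0 < \<epsilon>" "\<And>j. j \<in> {1..K} \<Longrightarrow> 0 \<le> \<alpha> j" "\<And>j. j \<in> {1..K} \<Longrightarrow> I (x j) < \<infinity>"
  shows "exp_neg (weighted_energy I K \<alpha> x / ennreal \<epsilon>)
    = exp (- ((\<Sum>j=1..K. \<alpha> j * enn2real (I (x j))) / \<epsilon>))"
proof -
  have "0 \<le> (\<Sum>j=1..K. \<alpha> j * enn2real (I (x j)))"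
    using assms by (intro sum_nonneg mult_nonneg_nonneg) auto
  moreover have "weighted_energy I K \<alpha> x = ennreal (\<Sum>j=1..K. \<alpha> j * enn2real (I (x j)))"
    using assms by (intro weighted_energy_finite)
  ultimately show ?thesis using exp_neg_divide[OF assms(1)] by simp
qed

text \<open>The numerator is the summand of the denominator at the identity; if the denominator
  vanishes, the quotient is 0. The bounds hold for infinite energies as well, so the estimator is
  bounded everywhere.\<close>

lemma INS_rho_bounds: "0 \<le> INS_rho I K \<alpha> \<epsilon> x" "INS_rho I K \<alpha> \<epsilon> x \<le> 1"
proof -
  let ?e = "\<lambda>\<tau> :: nat \<Rightarrow> nat. exp_neg (weighted_energy I K \<alpha> (\<lambda>j. x (\<tau> j)) / ennreal \<epsilon>)"
  have "?e (\<lambda>j. j) \<le> (\<Sum>\<tau> | \<tau> permutes {1..K}. ?e \<tau>)"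
    by (intro member_le_sum) (use permutes_id[of "{1..K}", unfolded id_def] in \<open>auto simp: exp_neg_nonneg finite_permutations simp del: permutes_id\<close>)
  then show "INS_rho I K \<alpha> \<epsilon> x \<le> 1"
    unfolding INS_rho_def by (auto simp: divide_le_eq_1 less_le intro!: sum_nonneg exp_neg_nonneg)
  show "0 \<le> INS_rho I K \<alpha> \<epsilon> x"
    unfolding INS_rho_def by (intro divide_nonneg_nonneg sum_nonneg exp_neg_nonneg)
qed

lemma INS_estimator_nonneg: "0 \<le> INS_estimator I A K \<alpha> \<epsilon> x"
  unfolding INS_estimator_def by (intro sum_nonneg mult_nonneg_nonneg INS_rho_bounds) auto

lemma card_permutes_atLeastAtMost: "card {\<sigma>. \<sigma> permutes {1..K}} = fact K"
  by (rule card_permutations) auto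

lemma INS_estimator_leI:
  assumes "\<And>\<sigma>. \<sigma> permutes {1..K} \<Longrightarrow> x (\<sigma> 1) \<in> A \<Longrightarrow> INS_rho I K \<alpha> \<epsilon> (\<lambda>j. x (\<sigma> j)) \<le> b" "0 \<le> b"
  shows "INS_estimator I A K \<alpha> \<epsilon> x \<le> fact K * b"
proof -
  have "INS_estimator I A K \<alpha> \<epsilon> x \<le> (\<Sum>\<sigma> | \<sigma> permutes {1..K}. b)"
    unfolding INS_estimator_def using assms by (intro sum_mono) (auto simp: indicator_def)
  then show ?thesis by (simp only: sum_constant card_permutes_atLeastAtMost of_nat_fact)
qed

text \<open>Composition with \<sigma> permutes the summands of the denominator, so the weights of
  all orderings share one denominator.\<close>

lemma INS_rho_permuted:
  assumes "0 < \<epsilon>" "\<And>j. j \<in> {1..K} \<Longrightarrow> 0 \<le> \<alpha> j" "\<And>j. j \<in> {1..K} \<Longrightarrow> I (x j) < \<infinity>"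
    and \<sigma>: "\<sigma> permutes {1..K}"
  shows "INS_rho I K \<alpha> \<epsilon> (\<lambda>j. x (\<sigma> j)) =
    exp (- ((\<Sum>j=1..K. \<alpha> j * enn2real (I (x (\<sigma> j)))) / \<epsilon>)) /
    (\<Sum>\<tau> | \<tau> permutes {1..K}. exp (- ((\<Sum>j=1..K. \<alpha> j * enn2real (I (x (\<tau> j)))) / \<epsilon>)))"
proof -
  have fin: "I (x (\<tau> j)) < \<infinity>" if "\<tau> permutes {1..K}" "j \<in> {1..K}" for \<tau> j
    using permutes_in_image[OF that(1), of j] that(2) assms(3) by blast
  have e: "exp_neg (weighted_energy I K \<alpha> (\<lambda>j. x (\<tau> j)) / ennreal \<epsilon>)
    = exp (- ((\<Sum>j=1..K. \<alpha> j * enn2real (I (x (\<tau> j)))) / \<epsilon>))" if "\<tau> permutes {1..K}" for \<tau>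
    by (rule exp_neg_weighted_energy) (use assms fin[OF that] in auto)
  have "(\<Sum>\<tau> | \<tau> permutes {1..K}. exp_neg (weighted_energy I K \<alpha> (\<lambda>j. x (\<sigma> (\<tau> j))) / ennreal \<epsilon>))
     = (\<Sum>\<tau> | \<tau> permutes {1..K}. exp_neg (weighted_energy I K \<alpha> (\<lambda>j. x (\<tau> j)) / ennreal \<epsilon>))"
    using setum_permutations_compose_left[OF \<sigma>, of "\<lambda>\<tau>. exp_neg (weighted_energy I K \<alpha> (\<lambda>j. x (\<tau> j)) / ennreal \<epsilon>)"]
    by (simp add: comp_def)
  also have "\<dots> = (\<Sum>\<tau> | \<tau> permutes {1..K}. exp (- ((\<Sum>j=1..K. \<alpha> j * enn2real (I (x (\<tau> j)))) / \<epsilon>)))"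
    by (intro sum.cong) (auto simp: e)
  finally show ?thesis unfolding INS_rho_def by (simp add: e[OF \<sigma>])
qed

text \<open>The bound is a product of functions of single coordinates, so its expectation
  factorizes. In the factor of coordinate \<open>j\<close>, the part \<open>\<alpha> j\<close>
  cancels the decay of the Gibbs weight at temperature \<open>\<epsilon> / \<alpha> j\<close>, and
  \<open>\<delta> * c\<close> is the decay that remains.\<close>

lemma INS_estimator_sq_le:
  fixes I :: "'a \<Rightarrow> ennreal" and A :: "'a set" and a :: real
  assumes \<epsilon>: "0 < \<epsilon>" and \<alpha>: "INS_weights K \<alpha>" and K: "1 \<le> K"
    and fin: "\<And>j. j \<in> {1..K} \<Longrightarrow> I (x j) < \<infinity>"
    and a: "\<And>y. y \<in> A \<Longrightarrow> ennreal a \<le> I y"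
    and \<delta>: "0 \<le> \<delta>" "\<delta> \<le> 1" and c: "\<And>j. j \<in> {1..K} \<Longrightarrow> c \<le> \<alpha> j"
  shows "(INS_estimator I A K \<alpha> \<epsilon> x)\<^sup>2
    \<le> (fact K)\<^sup>2 * exp (- ((1 - \<delta>) * INS_V K \<alpha> * a / \<epsilon>)) *
      (\<Prod>j=1..K. exp ((\<alpha> j - \<delta> * c) * enn2real (I (x j)) / \<epsilon>))"
proof -
  note W = INS_weightsD[OF \<alpha>]
  define u where "u j = enn2real (I (x j))" for j
  define E where "E \<sigma> = (\<Sum>j=1..K. \<alpha> j * u (\<sigma> j))" for \<sigma>
  \<comment> \<open>The exponent is halved because each weight is bounded by \<open>b\<close>
    through its square, and \<open>b\<close> is squared again after summing over \<sigma>.\<close>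
  define b where "b = exp (- (((1 - \<delta>) * INS_V K \<alpha> * a - (\<Sum>j=1..K. (\<alpha> j - \<delta> * c) * u j)) / (2 * \<epsilon>)))"
  have nn: "0 \<le> \<alpha> j" if "j \<in> {1..K}" for j using W(3) that by auto
  have u0: "0 \<le> u j" for j by (simp add: u_def)
  have rho: "INS_rho I K \<alpha> \<epsilon> (\<lambda>j. x (\<sigma> j)) \<le> b" if \<sigma>: "\<sigma> permutes {1..K}" and A: "x (\<sigma> 1) \<in> A" for \<sigma>
  proof -
    let ?r = "INS_rho I K \<alpha> \<epsilon> (\<lambda>j. x (\<sigma> j))"
    have in\<sigma>: "\<sigma> j \<in> {1..K}" if "j \<in> {1..K}" for j
      using permutes_in_image[OF \<sigma>] that by blast
    have r: "?r = exp (- (E \<sigma> / \<epsilon>)) / (\<Sum>\<tau> | \<tau> permutes {1..K}. exp (- (E \<tau> / \<epsilon>)))"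
      using INS_rho_permuted[where I=I and x=x, OF \<epsilon> nn fin \<sigma>] by (simp add: E_def u_def)
    have le: "?r \<le> exp (- ((E \<sigma> - E \<tau>) / \<epsilon>))" if "\<tau> permutes {1..K}" for \<tau>
    proof -
      have "exp (- (E \<tau> / \<epsilon>)) \<le> (\<Sum>\<tau> | \<tau> permutes {1..K}. exp (- (E \<tau> / \<epsilon>)))"
        using that by (intro member_le_sum) (auto simp: finite_permutations)
      then have "?r \<le> exp (- (E \<sigma> / \<epsilon>)) / exp (- (E \<tau> / \<epsilon>))"
        unfolding r by (intro divide_left_mono) (auto intro: mult_pos_pos less_le_trans[OF exp_gt_zero])
      then show ?thesis by (simp add: exp_diff[symmetric] diff_divide_distrib)
    qed
    obtain \<tau> where \<tau>: "\<tau> permutes {1..K}" "least_energy K \<alpha> u = E \<tau>"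
      using least_energy_attained[of K \<alpha> u] unfolding E_def by metis
    have a_le: "a \<le> u (\<sigma> 1)"
    proof -
      have "I (x (\<sigma> 1)) < \<infinity>" using in\<sigma>[of 1] fin K by auto
      then show ?thesis using a[OF A] unfolding u_def
        by (cases "I (x (\<sigma> 1))") (auto simp: ennreal_le_iff2)
    qed
    have "INS_V K \<alpha> * a \<le> INS_V K \<alpha> * u (\<sigma> 1)"
      using INS_V_ge_1[OF \<alpha> K] a_le by (intro mult_left_mono) auto
    also have "\<dots> \<le> 2 * E \<sigma> - least_energy K \<alpha> (\<lambda>j. u (\<sigma> j))"
      unfolding E_def using INS_V_mult_le_energy_gap[OF \<alpha> K, of "\<lambda>j. u (\<sigma> j)"] u0 by simp
    \<comment> \<open>Reordering the energies does not lower their least energy, because a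
      composition of permutations is again a permutation.\<close>
    also have "\<dots> \<le> 2 * E \<sigma> - E \<tau>"
      unfolding \<tau>(2)[symmetric]
    proof (intro diff_left_mono least_energy_geI)
      fix \<pi> assume "\<pi> permutes {1..K}"
      then show "least_energy K \<alpha> u \<le> (\<Sum>j=1..K. \<alpha> j * u (\<sigma> (\<pi> j)))"
        using least_energy_le[OF permutes_compose[OF _ \<sigma>, of \<pi>], of \<alpha> u] by (simp add: comp_def)
    qed
    finally have 1: "INS_V K \<alpha> * a \<le> 2 * E \<sigma> - E \<tau>" .
    have "(\<Sum>j=1..K. c * u j) = (\<Sum>j=1..K. c * u (\<sigma> j))"
      using sum.reindex_bij_betw[OF permutes_imp_bij[OF \<sigma>], of "\<lambda>j. c * u j"] by simp
    also have "\<dots> \<le> E \<sigma>" unfolding E_def using c u0 by (intro sum_mono mult_right_mono) auto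
    also have "\<dots> \<le> 2 * E \<sigma> - E \<tau>"
      using least_energy_le[OF \<sigma>, of \<alpha> u] \<tau>(2) by (simp add: E_def)
    finally have 2: "(\<Sum>j=1..K. c * u j) \<le> 2 * E \<sigma> - E \<tau>" .
    have "(1 - \<delta>) * (INS_V K \<alpha> * a) + \<delta> * (\<Sum>j=1..K. c * u j)
      \<le> (1 - \<delta>) * (2 * E \<sigma> - E \<tau>) + \<delta> * (2 * E \<sigma> - E \<tau>)"
      using \<delta> 1 2 by (intro add_mono mult_left_mono) auto
    then have G: "(1 - \<delta>) * INS_V K \<alpha> * a - (\<Sum>j=1..K. (\<alpha> j - \<delta> * c) * u j) \<le> (E \<sigma> - E \<tau>) + (E \<sigma> - E id)"
      by (simp add: E_def algebra_simps sum_subtractf sum_distrib_left)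
    \<comment> \<open>The two factors use different summands of the denominator: the minimizing
      \<tau> in one and the identity in the other. \<open>E id\<close> is the exponent lost to the
      Gibbs densities of the sample.\<close>
    have "?r * ?r \<le> exp (- ((E \<sigma> - E \<tau>) / \<epsilon>)) * exp (- ((E \<sigma> - E id) / \<epsilon>))"
      by (intro mult_mono le \<tau> permutes_id INS_rho_bounds) auto
    also have "\<dots> = exp (- (((E \<sigma> - E \<tau>) + (E \<sigma> - E id)) / \<epsilon>))"
      by (simp add: exp_add[symmetric] add_divide_distrib diff_divide_distrib)
    also have "\<dots> \<le> exp (- (((1 - \<delta>) * INS_V K \<alpha> * a - (\<Sum>j=1..K. (\<alpha> j - \<delta> * c) * u j)) / \<epsilon>))"
      using G \<epsilon> by (simp add: divide_right_mono)
    also have "\<dots> = b * b" using \<epsilon> by (simp add: b_def exp_add[symmetric] diff_divide_distrib)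
    finally have "?r\<^sup>2 \<le> b\<^sup>2" by (simp add: power2_eq_square)
    then show ?thesis by (rule power2_le_imp_le) (simp add: b_def)
  qed
  have "INS_estimator I A K \<alpha> \<epsilon> x \<le> fact K * b"
    by (rule INS_estimator_leI[OF rho]) (auto simp: b_def)
  then have *: "(INS_estimator I A K \<alpha> \<epsilon> x)\<^sup>2 \<le> (fact K)\<^sup>2 * b\<^sup>2"
    unfolding power_mult_distrib[symmetric] by (intro power_mono INS_estimator_nonneg)
  have "b\<^sup>2 = exp (- (((1 - \<delta>) * INS_V K \<alpha> * a - (\<Sum>j=1..K. (\<alpha> j - \<delta> * c) * u j)) / \<epsilon>))"
    using \<epsilon> by (simp add: b_def power2_eq_square exp_add[symmetric] diff_divide_distrib)
  also have "\<dots> = exp (- ((1 - \<delta>) * INS_V K \<alpha> * a / \<epsilon>)) * (\<Prod>j=1..K. exp ((\<alpha> j - \<delta> * c) * u j / \<epsilon>))"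
    by (simp add: exp_sum[symmetric] exp_add[symmetric] diff_divide_distrib sum_divide_distrib)
  finally show ?thesis using * by (simp add: u_def mult.assoc)
qed

text \<open>Keep the single summand \<sigma> and bound the denominator by \<open>K!\<close> times
  its largest term.\<close>

lemma INS_estimator_ge:
  fixes I :: "'a \<Rightarrow> ennreal" and x :: "nat \<Rightarrow> 'a"
  defines "u \<equiv> \<lambda>j. enn2real (I (x j))"
  assumes \<epsilon>: "0 < \<epsilon>" and \<alpha>: "INS_weights K \<alpha>"
    and fin: "\<And>j. j \<in> {1..K} \<Longrightarrow> I (x j) < \<infinity>"
    and \<sigma>: "\<sigma> permutes {1..K}" and A: "x (\<sigma> 1) \<in> A"
  shows "exp (- (((\<Sum>j=1..K. \<alpha> j * u (\<sigma> j)) - least_energy K \<alpha> u) / \<epsilon>)) / fact K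
    \<le> INS_estimator I A K \<alpha> \<epsilon> x"
proof -
  define E where "E \<sigma> = (\<Sum>j=1..K. \<alpha> j * u (\<sigma> j))" for \<sigma>
  define S where "S = (\<Sum>\<tau> | \<tau> permutes {1..K}. exp (- (E \<tau> / \<epsilon>)))"
  let ?L = "least_energy K \<alpha> u"
  have nn: "0 \<le> \<alpha> j" if "j \<in> {1..K}" for j using INS_weightsD(3)[OF \<alpha>] that by auto
  have "S \<le> (\<Sum>\<tau> | \<tau> permutes {1..K}. exp (- (?L / \<epsilon>)))"
    unfolding S_def E_def using \<epsilon>
    by (intro sum_mono) (simp add: divide_right_mono least_energy_le[simplified])
  then have S: "S \<le> fact K * exp (- (?L / \<epsilon>))"
    by (simp only: sum_constant card_permutes_atLeastAtMost of_nat_fact)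
  have "0 < S" unfolding S_def
    using permutes_id[of "{1..K}"] by (intro sum_pos) (auto simp: finite_permutations simp del: permutes_id)
  have "exp (- ((E \<sigma> - ?L) / \<epsilon>)) / fact K = exp (- (E \<sigma> / \<epsilon>)) / (fact K * exp (- (?L / \<epsilon>)))"
    by (simp add: exp_diff diff_divide_distrib exp_minus field_simps)
  also have "\<dots> \<le> exp (- (E \<sigma> / \<epsilon>)) / S"
    using S \<open>0 < S\<close> by (intro divide_left_mono) auto
  also have "\<dots> = INS_rho I K \<alpha> \<epsilon> (\<lambda>j. x (\<sigma> j)) * indicator A (x (\<sigma> 1))"
    using INS_rho_permuted[where I=I and x=x, OF \<epsilon> nn fin \<sigma>] A by (simp add: E_def u_def S_def)
  also have "\<dots> \<le> INS_estimator I A K \<alpha> \<epsilon> x"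
    unfolding INS_estimator_def using \<sigma>
    by (intro member_le_sum[where f="\<lambda>\<sigma>. INS_rho I K \<alpha> \<epsilon> (\<lambda>j. x (\<sigma> j)) * indicator A (x (\<sigma> 1))"])
      (auto simp: finite_permutations intro!: mult_nonneg_nonneg INS_rho_bounds)
  finally show ?thesis by (simp add: E_def)
qed

section \<open>From exponential bounds to a logarithmic limit\<close>

text \<open>The constants may depend on \<kappa>: their logarithms vanish after multiplication by
  \<epsilon>, and \<kappa> is arbitrary.\<close>

lemma tendsto_minus_elog:
  fixes f :: "real \<Rightarrow> real" and L :: real
  assumes upper: "\<And>\<kappa>. 0 < \<kappa> \<Longrightarrow> \<exists>C>0. \<forall>\<^sub>F \<epsilon> in at_right 0. f \<epsilon> \<le> C * exp (- ((L - \<kappa>) / \<epsilon>))"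
    and lower: "\<And>\<kappa>. 0 < \<kappa> \<Longrightarrow> \<exists>C>0. \<forall>\<^sub>F \<epsilon> in at_right 0. C * exp (- ((L + \<kappa>) / \<epsilon>)) \<le> f \<epsilon>"
  shows "((\<lambda>\<epsilon>. - (ereal \<epsilon> * elog (f \<epsilon>))) \<longlongrightarrow> ereal L) (at_right 0)"
proof -
  \<comment> \<open>The lower bound keeps \<open>f\<close> away from the case where
    \<open>elog\<close> is \<open>-\<infinity>\<close>, so the limit can be computed with
    \<open>ln\<close>.\<close>
  have pos: "\<forall>\<^sub>F \<epsilon> in at_right 0. 0 < f \<epsilon>"
  proof -
    obtain C where "C > 0" "\<forall>\<^sub>F \<epsilon> in at_right 0. C * exp (- ((L + 1) / \<epsilon>)) \<le> f \<epsilon>"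
      using lower[of 1] by auto
    then show ?thesis by (auto elim!: eventually_mono intro: less_le_trans[rotated])
  qed
  have small: "\<forall>\<^sub>F \<epsilon> in at_right (0::real). \<bar>\<epsilon> * ln C\<bar> < \<kappa>" if "0 < \<kappa>" for C \<kappa> :: real
  proof -
    have "((\<lambda>\<epsilon>. \<bar>\<epsilon> * ln C\<bar>) \<longlongrightarrow> \<bar>0 * ln C\<bar>) (at_right 0)"
      by (intro tendsto_intros)
    then show ?thesis using that by (intro order_tendstoD(2)) auto
  qed
  have eps: "\<forall>\<^sub>F \<epsilon> in at_right (0::real). 0 < \<epsilon>" by (simp add: eventually_at_right_less)
  have "((\<lambda>\<epsilon>. - (\<epsilon> * ln (f \<epsilon>))) \<longlongrightarrow> L) (at_right 0)"
  proof (rule order_tendstoI)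
    fix l assume "l < L"
    \<comment> \<open>Half of the gap pays for the loss in the exponent, the other half for
      \<open>\<epsilon> * ln C\<close>.\<close>
    define \<kappa> where "\<kappa> = (L - l) / 2"
    have \<kappa>: "0 < \<kappa>" and l: "l = L - 2 * \<kappa>" using \<open>l < L\<close> by (simp_all add: \<kappa>_def field_simps)
    obtain C where "C > 0" and C: "\<forall>\<^sub>F \<epsilon> in at_right 0. f \<epsilon> \<le> C * exp (- ((L - \<kappa>) / \<epsilon>))"
      using upper[OF \<kappa>] by auto
    show "\<forall>\<^sub>F \<epsilon> in at_right 0. l < - (\<epsilon> * ln (f \<epsilon>))"
      using C eps pos small[OF \<kappa>, of C]
    proof eventually_elim
      case (elim \<epsilon>)
      then have "ln (f \<epsilon>) \<le> ln (C * exp (- ((L - \<kappa>) / \<epsilon>)))" using \<open>C > 0\<close> by simp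
      also have "\<dots> = ln C - (L - \<kappa>) / \<epsilon>" using \<open>C > 0\<close> by (simp add: ln_mult)
      finally have "\<epsilon> * ln (f \<epsilon>) \<le> \<epsilon> * (ln C - (L - \<kappa>) / \<epsilon>)" using elim by (intro mult_left_mono) auto
      also have "\<dots> = \<epsilon> * ln C - (L - \<kappa>)" using elim by (simp add: field_simps)
      finally show ?case using elim(4) l unfolding abs_less_iff by linarith
    qed
  next
    fix l assume "l > L"
    define \<kappa> where "\<kappa> = (l - L) / 2"
    have \<kappa>: "0 < \<kappa>" and l: "l = L + 2 * \<kappa>" using \<open>l > L\<close> by (simp_all add: \<kappa>_def field_simps)
    obtain C where "C > 0" and C: "\<forall>\<^sub>F \<epsilon> in at_right 0. C * exp (- ((L + \<kappa>) / \<epsilon>)) \<le> f \<epsilon>"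
      using lower[OF \<kappa>] by auto
    show "\<forall>\<^sub>F \<epsilon> in at_right 0. - (\<epsilon> * ln (f \<epsilon>)) < l"
      using C eps pos small[OF \<kappa>, of C]
    proof eventually_elim
      case (elim \<epsilon>)
      then have "ln (C * exp (- ((L + \<kappa>) / \<epsilon>))) \<le> ln (f \<epsilon>)" using \<open>C > 0\<close> by simp
      moreover have "ln (C * exp (- ((L + \<kappa>) / \<epsilon>))) = ln C - (L + \<kappa>) / \<epsilon>" using \<open>C > 0\<close> by (simp add: ln_mult)
      ultimately have "\<epsilon> * (ln C - (L + \<kappa>) / \<epsilon>) \<le> \<epsilon> * ln (f \<epsilon>)" using elim by (intro mult_left_mono) auto
      moreover have "\<epsilon> * (ln C - (L + \<kappa>) / \<epsilon>) = \<epsilon> * ln C - (L + \<kappa>)" using elim by (simp add: field_simps)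
      ultimately show ?case using elim(4) l unfolding abs_less_iff by linarith
    qed
  qed
  then have "((\<lambda>\<epsilon>. ereal (- (\<epsilon> * ln (f \<epsilon>)))) \<longlongrightarrow> ereal L) (at_right 0)" by simp
  then show ?thesis
  proof (rule Lim_transform_eventually)
    show "\<forall>\<^sub>F \<epsilon> in at_right 0. ereal (- (\<epsilon> * ln (f \<epsilon>))) = - (ereal \<epsilon> * elog (f \<epsilon>))"
      using pos by eventually_elim (simp add: elog_def)
  qed
qed

subsection \<open>Gibbs measures with a large deviation principle\<close>

lemma ennreal_divide_left_mono:
  fixes x y z :: ennreal
  assumes "0 < x" "x \<le> y" "y < \<infinity>"
  shows "z / y \<le> z / x"
proof (cases x y rule: ennreal2_cases)
  case (real_real r s)
  with assms have "0 < r" "0 < s" "r \<le> s" by auto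
  with real_real show ?thesis
    unfolding divide_ennreal_def by (auto simp: inverse_ennreal intro!: mult_left_mono ennreal_leI)
qed (use assms in \<open>auto simp: top_unique\<close>)

locale gibbs_ldp =
  fixes \<gamma> :: "'a::polish_space measure" and I :: "'a \<Rightarrow> ennreal" and \<mu> :: "real \<Rightarrow> 'a measure"
  assumes sets_\<gamma>: "sets \<gamma> = sets borel"
    and cont: "\<And>x. I x < \<infinity> \<Longrightarrow> isCont I x"
    and Z: "\<And>\<epsilon>. 0 < \<epsilon> \<Longrightarrow> 0 < gibbs_Z \<gamma> I \<epsilon>" "\<And>\<epsilon>. 0 < \<epsilon> \<Longrightarrow> gibbs_Z \<gamma> I \<epsilon> < \<infinity>"
    and prob_\<mu>: "\<And>\<epsilon>. 0 < \<epsilon> \<Longrightarrow> prob_space (\<mu> \<epsilon>)"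
    and \<mu>_eq: "\<And>\<epsilon>. 0 < \<epsilon> \<Longrightarrow> \<mu> \<epsilon> = gibbs_measure \<gamma> I \<epsilon>"
    and LDP: "satisfies_LDP \<mu> I"
begin

text \<open>A strict bound forces a finite value, so continuity on the domain of finiteness
  suffices, even for infinite \<open>a\<close>. This yields both the Borel measurability of
  \<open>I\<close> and the open regions of low energy.\<close>

lemma open_sublevel: "open {x. I x < a}"
proof (rule Topological_Spaces.openI)
  fix x assume "x \<in> {x. I x < a}"
  then have "I x < a" by simp
  moreover from this have "(I \<longlongrightarrow> I x) (nhds x)"
    using cont[of x] top_greatest[of a] by (simp add: less_le_trans continuous_at tendsto_at_iff_tendsto_nhds)
  ultimately have "eventually (\<lambda>y. I y < a) (nhds x)" by (metis order_tendstoD(2))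
  then show "\<exists>T. open T \<and> x \<in> T \<and> T \<subseteq> {x. I x < a}"
    unfolding eventually_nhds by auto
qed

lemma measurable_I [measurable]: "I \<in> borel_measurable borel"
  by (rule borel_measurableI_less) (simp add: open_sublevel)

lemma measurable_\<gamma> [measurable_cong]: "sets \<gamma> = sets borel"
  by (rule sets_\<gamma>)

lemma sets_\<mu>: "0 < \<epsilon> \<Longrightarrow> sets (\<mu> \<epsilon>) = sets borel"
  by (simp add: \<mu>_eq gibbs_measure_def sets_\<gamma>)

lemma nn_integral_\<mu>:
  assumes \<epsilon>: "0 < \<epsilon>" and [measurable]: "g \<in> borel_measurable borel"
  shows "(\<integral>\<^sup>+x. g x \<partial>\<mu> \<epsilon>)
    = (\<integral>\<^sup>+x. ennreal (exp_neg (I x / ennreal \<epsilon>)) * g x \<partial>\<gamma>) / gibbs_Z \<gamma> I \<epsilon>"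
proof -
  have "(\<integral>\<^sup>+x. g x \<partial>\<mu> \<epsilon>) = (\<integral>\<^sup>+x. (ennreal (exp_neg (I x / ennreal \<epsilon>)) / gibbs_Z \<gamma> I \<epsilon>) * g x \<partial>\<gamma>)"
    unfolding \<mu>_eq[OF \<epsilon>] gibbs_measure_def by (rule nn_integral_density) measurable
  also have "\<dots> = (\<integral>\<^sup>+x. (ennreal (exp_neg (I x / ennreal \<epsilon>)) * g x) / gibbs_Z \<gamma> I \<epsilon> \<partial>\<gamma>)"
    by (simp add: divide_ennreal_def mult_ac)
  also have "\<dots> = (\<integral>\<^sup>+x. ennreal (exp_neg (I x / ennreal \<epsilon>)) * g x \<partial>\<gamma>) / gibbs_Z \<gamma> I \<epsilon>"
    by (rule nn_integral_divide) measurable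
  finally show ?thesis .
qed

text \<open>The density vanishes where \<open>I\<close> is infinite, so the default value 0 of
  \<open>enn2real\<close> there does not affect integrals.\<close>

lemma AE_\<mu>_finite:
  assumes \<epsilon>: "0 < \<epsilon>"
  shows "AE x in \<mu> \<epsilon>. I x < \<infinity>"
  unfolding \<mu>_eq[OF \<epsilon>] gibbs_measure_def
  by (subst AE_density) (auto simp: exp_neg_divide[OF \<epsilon>] top.not_eq_extremum)

text \<open>A \<gamma>-null set is null for every Gibbs measure, so its logarithmic rate is
  \<open>-\<infinity>\<close>. The lower bound of the large deviation principle then makes
  \<open>I\<close> infinite on all of \<open>G\<close>.\<close>

lemma emeasure_open_pos:
  assumes G: "open G" "x \<in> G" "I x < \<infinity>"
  shows "0 < emeasure \<gamma> G"
proof (rule ccontr)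
  assume "\<not> ?thesis"
  then have 0: "emeasure \<gamma> G = 0" by (simp add: zero_less_iff_neq_zero)
  have [measurable]: "G \<in> sets borel" using G by simp
  have "measure (\<mu> \<epsilon>) G = 0" if \<epsilon>: "0 < \<epsilon>" for \<epsilon>
  proof -
    have "AE x in \<gamma>. x \<notin> G" using 0 by (intro AE_not_in) (simp add: null_sets_def sets_\<gamma>)
    then have "AE x in \<mu> \<epsilon>. x \<notin> G"
      unfolding \<mu>_eq[OF \<epsilon>] gibbs_measure_def by (subst AE_density) auto
    then have "emeasure (\<mu> \<epsilon>) G = 0"
      by (subst (asm) AE_iff_measurable[of G]) (auto simp: sets_\<mu>[OF \<epsilon>] sets_eq_imp_space_eq[OF sets_\<mu>[OF \<epsilon>]])
    then show ?thesis by (simp add: measure_def)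
  qed
  then have "\<forall>\<^sub>F \<epsilon> in at_right 0. ereal \<epsilon> * elog (measure (\<mu> \<epsilon>) G) = -\<infinity>"
    by (auto simp: elog_def eventually_at_right_less elim!: eventually_mono[rotated] intro!: eventually_mono[OF eventually_at_right_less])
  then have "Liminf (at_right 0) (\<lambda>\<epsilon>. ereal \<epsilon> * elog (measure (\<mu> \<epsilon>) G)) = Liminf (at_right 0) (\<lambda>\<epsilon>::real. -\<infinity>)"
    by (rule Liminf_eq)
  also have "\<dots> = -\<infinity>" by (rule Liminf_const) simp
  finally have "- enn2ereal (INF x\<in>G. I x) \<le> -\<infinity>"
    using LDP G(1) unfolding satisfies_LDP_def by metis
  then have "enn2ereal (INF x\<in>G. I x) = \<infinity>" by simp
  then have "(INF x\<in>G. I x) = \<infinity>" by (simp add: enn2ereal_eq_top_iff)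
  moreover have "(INF x\<in>G. I x) \<le> I x" using G by (intro INF_lower)
  ultimately show False using G by simp
qed

text \<open>The whole space has probability 1, hence rate 0; the large deviation upper bound for
  this closed set gives the claim.\<close>

lemma INF_I: "(INF x. I x) = 0"
proof -
  have "\<forall>\<^sub>F \<epsilon> in at_right 0. ereal \<epsilon> * elog (measure (\<mu> \<epsilon>) UNIV) = 0"
  proof (rule eventually_mono[OF eventually_at_right_less])
    fix \<epsilon> :: real assume \<epsilon>: "0 < \<epsilon>"
    interpret prob_space "\<mu> \<epsilon>" by (rule prob_\<mu>[OF \<epsilon>])
    have "measure (\<mu> \<epsilon>) UNIV = 1"
      using prob_space sets_eq_imp_space_eq[OF sets_\<mu>[OF \<epsilon>]] by simp
    then show "ereal \<epsilon> * elog (measure (\<mu> \<epsilon>) UNIV) = 0" by (simp add: elog_def zero_ereal_def[symmetric])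
  qed
  then have "Limsup (at_right 0) (\<lambda>\<epsilon>. ereal \<epsilon> * elog (measure (\<mu> \<epsilon>) UNIV)) = Limsup (at_right 0) (\<lambda>\<epsilon>::real. 0)"
    by (rule Limsup_eq)
  also have "\<dots> = 0" by (rule Limsup_const) simp
  finally have "0 \<le> - enn2ereal (INF x. I x)"
    using LDP closed_UNIV unfolding satisfies_LDP_def by metis
  then have "enn2ereal (INF x. I x) \<le> 0" by (simp add: ereal_uminus_le_reorder)
  then show ?thesis by (metis enn2ereal_nonneg order_antisym enn2ereal_inject zero_ennreal.rep_eq)
qed

lemma ex_I_less:
  assumes "0 < \<eta>"
  obtains x where "I x < \<eta>"
  using INF_I assms by (metis INF_less_iff UNIV_I)

section \<open>Normalizing constants and open sets at low temperature\<close>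

lemma gibbs_Z_mono:
  assumes "0 < \<epsilon>" "\<epsilon> \<le> \<epsilon>'"
  shows "gibbs_Z \<gamma> I \<epsilon> \<le> gibbs_Z \<gamma> I \<epsilon>'"
  unfolding gibbs_Z_def using assms
  by (intro nn_integral_mono ennreal_leI) (auto simp: exp_neg_divide intro!: divide_left_mono)

text \<open>The set where \<open>I\<close> is below \<eta> has positive \<gamma>-measure, and the
  integrand is at least \<open>exp (- (\<eta> / \<epsilon>))\<close> there. As \<eta> is arbitrary,
  the normalizing constants do not decay exponentially in \<open>1 / \<epsilon>\<close>.\<close>

lemma gibbs_Z_ge:
  assumes "0 < \<eta>"
  obtains g where "0 < g" "\<And>\<epsilon>. 0 < \<epsilon> \<Longrightarrow> ennreal (g * exp (- (\<eta> / \<epsilon>))) \<le> gibbs_Z \<gamma> I \<epsilon>"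
proof -
  let ?G = "{x. I x < ennreal \<eta>}"
  have [measurable]: "?G \<in> sets borel" using open_sublevel by simp
  obtain x where x: "I x < ennreal \<eta>" using ex_I_less[of "ennreal \<eta>"] assms by auto
  then have "0 < emeasure \<gamma> ?G"
    using less_trans[OF x ennreal_less_top] by (intro emeasure_open_pos[OF open_sublevel, of x]) auto
  \<comment> \<open>A number strictly between 0 and the measure is positive and finite at
    once.\<close>
  then obtain g' where g': "0 < g'" "g' < emeasure \<gamma> ?G" using dense by blast
  define g where "g = enn2real g'"
  have g: "0 < g" "ennreal g \<le> emeasure \<gamma> ?G"
    using g' by (auto simp: g_def enn2real_positive_iff less_top[symmetric] ennreal_enn2real_if)
  have "ennreal (g * exp (- (\<eta> / \<epsilon>))) \<le> gibbs_Z \<gamma> I \<epsilon>" if \<epsilon>: "0 < \<epsilon>" for \<epsilon>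
  proof -
    have "ennreal (g * exp (- (\<eta> / \<epsilon>))) \<le> ennreal (exp (- (\<eta> / \<epsilon>))) * emeasure \<gamma> ?G"
      using g mult_left_mono[OF g(2), of "ennreal (exp (- (\<eta> / \<epsilon>)))"]
      by (simp add: ennreal_mult mult.commute)
    also have "\<dots> = (\<integral>\<^sup>+x. ennreal (exp (- (\<eta> / \<epsilon>))) * indicator ?G x \<partial>\<gamma>)"
      by (rule nn_integral_cmult_indicator[symmetric]) (simp add: sets_\<gamma>)
    also have "\<dots> \<le> gibbs_Z \<gamma> I \<epsilon>"
      unfolding gibbs_Z_def
    proof (rule nn_integral_mono)
      fix x
      show "ennreal (exp (- (\<eta> / \<epsilon>))) * indicator ?G x \<le> ennreal (exp_neg (I x / ennreal \<epsilon>))"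
      proof (cases "I x < ennreal \<eta>")
        case True
        then have "I x \<noteq> \<infinity>" "enn2real (I x) \<le> \<eta>"
          using assms by (auto intro: enn2real_leI order.strict_implies_order)
        then show ?thesis using \<epsilon> by (auto simp: exp_neg_divide True intro!: ennreal_leI divide_right_mono)
      qed simp
    qed
    finally show ?thesis .
  qed
  then show thesis using g(1) that by blast
qed

text \<open>The exponential tilt turns the Gibbs weight at temperature \<epsilon> into the one at
  \<epsilon>'. Where \<open>I\<close> is infinite both weights are 0.\<close>

lemma nn_integral_exp_\<mu>:
  assumes \<epsilon>: "0 < \<epsilon>" and \<epsilon>': "0 < \<epsilon>'"
  shows "(\<integral>\<^sup>+x. ennreal (exp ((1 / \<epsilon> - 1 / \<epsilon>') * enn2real (I x))) \<partial>\<mu> \<epsilon>)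
    = gibbs_Z \<gamma> I \<epsilon>' / gibbs_Z \<gamma> I \<epsilon>"
proof -
  have "ennreal (exp_neg (I x / ennreal \<epsilon>)) * ennreal (exp ((1 / \<epsilon> - 1 / \<epsilon>') * enn2real (I x)))
    = ennreal (exp_neg (I x / ennreal \<epsilon>'))" for x
    using \<epsilon> \<epsilon>' by (simp add: exp_neg_divide ennreal_mult'[symmetric] exp_add[symmetric] left_diff_distrib)
  then show ?thesis by (subst nn_integral_\<mu>[OF \<epsilon>]) (simp_all add: gibbs_Z_def)
qed

text \<open>The Gibbs weight on \<open>G\<close> is at least
  \<open>exp (- (b / \<epsilon>))\<close>, and for \<epsilon> \<le> 1 the normalizing constant is at
  most its value at 1. This leaves a prefactor independent of \<epsilon>.\<close>

lemma emeasure_\<mu>_ge: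
  assumes G: "open G" "x \<in> G" "I x < \<infinity>" and b: "\<And>y. y \<in> G \<Longrightarrow> I y \<le> ennreal b" "0 \<le> b"
  obtains g where "0 < g" "\<And>\<epsilon>. 0 < \<epsilon> \<Longrightarrow> \<epsilon> \<le> 1 \<Longrightarrow> g * exp (- (b / \<epsilon>)) \<le> measure (\<mu> \<epsilon>) G"
proof -
  have [measurable]: "G \<in> sets borel" using G by simp
  have "0 < emeasure \<gamma> G / gibbs_Z \<gamma> I 1"
    using emeasure_open_pos[OF G] Z(2)[of 1] by (simp add: zero_less_iff_neq_zero ennreal_divide_eq_0_iff)
  then obtain g' where g': "0 < g'" "g' < emeasure \<gamma> G / gibbs_Z \<gamma> I 1" using dense by blast
  define g where "g = enn2real g'"
  have g: "0 < g" "ennreal g \<le> emeasure \<gamma> G / gibbs_Z \<gamma> I 1"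
    using g' by (auto simp: g_def enn2real_positive_iff less_top[symmetric] ennreal_enn2real_if)
  have "g * exp (- (b / \<epsilon>)) \<le> measure (\<mu> \<epsilon>) G" if \<epsilon>: "0 < \<epsilon>" "\<epsilon> \<le> 1" for \<epsilon>
  proof -
    interpret prob_space "\<mu> \<epsilon>" by (rule prob_\<mu>[OF \<epsilon>(1)])
    have "ennreal (g * exp (- (b / \<epsilon>))) \<le> ennreal (exp (- (b / \<epsilon>))) * (emeasure \<gamma> G / gibbs_Z \<gamma> I 1)"
      using g mult_left_mono[OF g(2), of "ennreal (exp (- (b / \<epsilon>)))"]
      by (simp add: ennreal_mult mult.commute)
    also have "\<dots> \<le> ennreal (exp (- (b / \<epsilon>))) * (emeasure \<gamma> G / gibbs_Z \<gamma> I \<epsilon>)"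
      using \<epsilon> Z by (intro mult_left_mono ennreal_divide_left_mono gibbs_Z_mono) auto
    also have "\<dots> = (\<integral>\<^sup>+x. ennreal (exp (- (b / \<epsilon>))) * indicator G x \<partial>\<gamma>) / gibbs_Z \<gamma> I \<epsilon>"
      by (subst nn_integral_cmult_indicator) (simp_all add: sets_\<gamma> ennreal_times_divide)
    also have "\<dots> \<le> (\<integral>\<^sup>+x. ennreal (exp_neg (I x / ennreal \<epsilon>)) * indicator G x \<partial>\<gamma>) / gibbs_Z \<gamma> I \<epsilon>"
    proof (intro divide_right_mono_ennreal nn_integral_mono)
      fix y
      show "ennreal (exp (- (b / \<epsilon>))) * indicator G y \<le> ennreal (exp_neg (I y / ennreal \<epsilon>)) * indicator G y"
      proof (cases "y \<in> G")
        case True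
        then have "I y \<noteq> \<infinity>" "enn2real (I y) \<le> b"
          using b by (auto intro: enn2real_leI simp: top_unique dest!: b(1))
        then show ?thesis using \<epsilon> by (auto simp: exp_neg_divide True intro!: ennreal_leI divide_right_mono)
      qed simp
    qed
    also have "\<dots> = (\<integral>\<^sup>+x. indicator G x \<partial>\<mu> \<epsilon>)" by (rule nn_integral_\<mu>[OF \<epsilon>(1), symmetric]) simp
    also have "\<dots> = ennreal (measure (\<mu> \<epsilon>) G)"
      by (simp add: sets_\<mu>[OF \<epsilon>(1)] emeasure_eq_measure)
    finally show ?thesis by (simp add: ennreal_le_iff)
  qed
  then show thesis using g(1) that by blast
qed

subsection \<open>The second moment\<close>

lemma sample_measurable:
  assumes "INS_sample \<mu> K \<alpha> \<epsilon> P X" "j \<in> {1..K}"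
  shows "X j \<in> borel_measurable P"
  using assms prob_space.indep_vars_def[of P "\<lambda>_. borel" X "{1..K}"]
  unfolding INS_sample_def by blast

lemma nn_integral_sample_prod:
  assumes S: "INS_sample \<mu> K \<alpha> \<epsilon> P X"
    and g: "\<And>j. j \<in> {1..K} \<Longrightarrow> g j \<in> borel_measurable borel"
  shows "(\<integral>\<^sup>+\<omega>. (\<Prod>j=1..K. g j (X j \<omega>)) \<partial>P) = (\<Prod>j=1..K. \<integral>\<^sup>+x. g j x \<partial>\<mu> (\<epsilon> / \<alpha> j))"
proof -
  interpret prob_space P using S by (simp add: INS_sample_def)
  have "indep_vars (\<lambda>_. borel) (\<lambda>j \<omega>. g j (X j \<omega>)) {1..K}"
    by (rule indep_vars_compose2[where M'="\<lambda>_. borel" and X=X])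
      (use S g in \<open>simp_all add: INS_sample_def\<close>)
  then have "(\<integral>\<^sup>+\<omega>. (\<Prod>j=1..K. g j (X j \<omega>)) \<partial>P) = (\<Prod>j=1..K. \<integral>\<^sup>+\<omega>. g j (X j \<omega>) \<partial>P)"
    by (intro indep_vars_nn_integral) auto
  also have "\<dots> = (\<Prod>j=1..K. \<integral>\<^sup>+x. g j x \<partial>\<mu> (\<epsilon> / \<alpha> j))"
  proof (rule prod.cong[OF refl])
    fix j assume j: "j \<in> {1..K}"
    have "\<mu> (\<epsilon> / \<alpha> j) = distr P borel (X j)" using S j by (simp add: INS_sample_def)
    then show "(\<integral>\<^sup>+\<omega>. g j (X j \<omega>) \<partial>P) = (\<integral>\<^sup>+x. g j x \<partial>\<mu> (\<epsilon> / \<alpha> j))"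
      using nn_integral_distr[OF sample_measurable[OF S j], of "g j"] g[OF j] by simp
  qed
  finally show ?thesis .
qed

lemma AE_sample_finite:
  assumes \<epsilon>: "0 < \<epsilon>" and \<alpha>: "\<And>j. j \<in> {1..K} \<Longrightarrow> 0 < \<alpha> j" and S: "INS_sample \<mu> K \<alpha> \<epsilon> P X"
  shows "AE \<omega> in P. \<forall>j\<in>{1..K}. I (X j \<omega>) < \<infinity>"
proof (rule AE_finite_allI)
  fix j assume j: "j \<in> {1..K}"
  have "distr P borel (X j) = \<mu> (\<epsilon> / \<alpha> j)" using S j unfolding INS_sample_def by blast
  then have "AE x in distr P borel (X j). I x < \<infinity>"
    using AE_\<mu>_finite[of "\<epsilon> / \<alpha> j"] \<epsilon> \<alpha>[OF j] by (metis divide_pos_pos)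
  then show "AE \<omega> in P. I (X j \<omega>) < \<infinity>" by (rule AE_distrD[OF sample_measurable[OF S j]])
qed simp

lemma INS_estimator_measurable:
  assumes S: "INS_sample \<mu> K \<alpha> \<epsilon> P X" and K: "1 \<le> K" and A: "A \<in> sets borel"
  shows "(\<lambda>\<omega>. INS_estimator I A K \<alpha> \<epsilon> (\<lambda>j. X j \<omega>)) \<in> borel_measurable P"
proof -
  have X: "(\<lambda>\<omega>. X (\<sigma> j) \<omega>) \<in> borel_measurable P" if "\<sigma> permutes {1..K}" "j \<in> {1..K}" for \<sigma> j
    using sample_measurable[OF S, of "\<sigma> j"] permutes_in_image[OF that(1), of j] that(2) by simp
  have e: "(\<lambda>\<omega>. exp_neg (weighted_energy I K \<alpha> (\<lambda>j. X (\<sigma> j) \<omega>) / ennreal \<epsilon>)) \<in> borel_measurable P"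
    if "\<sigma> permutes {1..K}" for \<sigma>
  proof -
    have [measurable]: "(\<lambda>\<omega>. I (X (\<sigma> j) \<omega>)) \<in> borel_measurable P" if "j \<in> {1..K}" for j
      using measurable_compose[OF X[OF \<open>\<sigma> permutes {1..K}\<close> that] measurable_I] .
    have [measurable]: "(\<lambda>\<omega>. weighted_energy I K \<alpha> (\<lambda>j. X (\<sigma> j) \<omega>)) \<in> borel_measurable P"
      unfolding weighted_energy_def by measurable
    show ?thesis by measurable
  qed
  have "(\<lambda>\<omega>. INS_rho I K \<alpha> \<epsilon> (\<lambda>j. X (\<sigma> j) \<omega>) * indicator A (X (\<sigma> 1) \<omega>)) \<in> borel_measurable P"
    if \<sigma>: "\<sigma> permutes {1..K}" for \<sigma>
  proof -
    have "(\<lambda>\<omega>. INS_rho I K \<alpha> \<epsilon> (\<lambda>j. X (\<sigma> j) \<omega>)) \<in> borel_measurable P"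
      unfolding INS_rho_def
      by (intro borel_measurable_divide borel_measurable_sum e[OF \<sigma>])
        (use e[OF permutes_compose[OF _ \<sigma>]] in \<open>auto simp: comp_def\<close>)
    moreover have "(\<lambda>\<omega>. indicator A (X (\<sigma> 1) \<omega>) :: real) \<in> borel_measurable P"
      using X[OF \<sigma>, of 1] K A by (intro measurable_compose[OF _ borel_measurable_indicator]) auto
    ultimately show ?thesis by (rule borel_measurable_times)
  qed
  then show ?thesis unfolding INS_estimator_def by (intro borel_measurable_sum) auto
qed

lemma integrable_INS_estimator_sq:
  assumes S: "INS_sample \<mu> K \<alpha> \<epsilon> P X" and K: "1 \<le> K" and A: "A \<in> sets borel"
  shows "integrable P (\<lambda>\<omega>. (INS_estimator I A K \<alpha> \<epsilon> (\<lambda>j. X j \<omega>))\<^sup>2)"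
proof -
  interpret prob_space P using S by (simp add: INS_sample_def)
  note [measurable] = INS_estimator_measurable[OF assms]
  have "INS_estimator I A K \<alpha> \<epsilon> (\<lambda>j. X j \<omega>) \<le> fact K * 1" for \<omega>
    by (intro INS_estimator_leI INS_rho_bounds) simp
  then show ?thesis
    by (intro integrable_const_bound[where B="(fact K)\<^sup>2"] AE_I2)
      (auto intro!: power_mono INS_estimator_nonneg)
qed

section \<open>Matching exponential bounds and the limit\<close>

text \<open>By independence the pointwise bound integrates to a product of ratios of normalizing
  constants. The constant is fixed before \<epsilon>, \<open>P\<close> and \<open>X\<close>, so that
  it serves a whole family of samples.\<close>

lemma second_moment_upper:
  fixes a \<delta> \<eta> :: real
  assumes \<alpha>: "INS_weights K \<alpha>" and \<alpha>pos: "\<And>j. j \<in> {1..K} \<Longrightarrow> 0 < \<alpha> j" and K: "1 \<le> K"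
    and A: "A \<in> sets borel" and a: "\<And>y. y \<in> A \<Longrightarrow> ennreal a \<le> I y"
    and \<delta>: "0 < \<delta>" "\<delta> \<le> 1" and \<eta>: "0 < \<eta>"
  obtains C where "0 < C"
    "\<And>\<epsilon> (P :: 'b measure) X. 0 < \<epsilon> \<Longrightarrow> \<epsilon> \<le> \<delta> * \<alpha> K \<Longrightarrow> INS_sample \<mu> K \<alpha> \<epsilon> P X \<Longrightarrow>
      (\<integral>\<omega>. (INS_estimator I A K \<alpha> \<epsilon> (\<lambda>j. X j \<omega>))\<^sup>2 \<partial>P)
        \<le> C * exp (- (((1 - \<delta>) * (INS_V K \<alpha> * a) - K * \<eta>) / \<epsilon>))"
proof -
  note W = INS_weightsD[OF \<alpha>]
  define c where "c = \<alpha> K"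
  have c: "0 < c" "c \<le> \<alpha> j" if "j \<in> {1..K}" for j
    using \<alpha>pos[of K] W(2)[of j K] K that by (auto simp: c_def)
  have c0: "0 < c" using c(1)[of 1] K by simp
  obtain g where g: "0 < g" "\<And>\<epsilon>. 0 < \<epsilon> \<Longrightarrow> ennreal (g * exp (- (\<eta> / \<epsilon>))) \<le> gibbs_Z \<gamma> I \<epsilon>"
    using gibbs_Z_ge[OF \<eta>] by blast
  obtain z where z: "0 < z" "gibbs_Z \<gamma> I 1 = ennreal z"
    using Z[of 1] by (cases "gibbs_Z \<gamma> I 1") auto
  define C where "C = (fact K)\<^sup>2 * (z / g) ^ K"
  have bound: "(\<integral>\<omega>. (INS_estimator I A K \<alpha> \<epsilon> (\<lambda>j. X j \<omega>))\<^sup>2 \<partial>P)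
        \<le> C * exp (- (((1 - \<delta>) * (INS_V K \<alpha> * a) - K * \<eta>) / \<epsilon>))"
    if \<epsilon>: "0 < \<epsilon>" "\<epsilon> \<le> \<delta> * \<alpha> K" and S: "INS_sample \<mu> K \<alpha> \<epsilon> P X" for \<epsilon> and P :: "'b measure" and X
  proof -
    interpret prob_space P using S by (simp add: INS_sample_def)
    let ?est = "\<lambda>\<omega>. (INS_estimator I A K \<alpha> \<epsilon> (\<lambda>j. X j \<omega>))\<^sup>2"
    define D where "D = (fact K)\<^sup>2 * exp (- ((1 - \<delta>) * INS_V K \<alpha> * a / \<epsilon>))"
    define h where "h j y = ennreal (exp ((\<alpha> j - \<delta> * c) * enn2real (I y) / \<epsilon>))" for j y
    have h_meas: "h j \<in> borel_measurable borel" for j unfolding h_def[abs_def] by measurable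
    have factor: "(\<integral>\<^sup>+y. h j y \<partial>\<mu> (\<epsilon> / \<alpha> j)) \<le> ennreal (z / g * exp (\<eta> / \<epsilon>))" if j: "j \<in> {1..K}" for j
    proof -
      \<comment> \<open>The exponent \<open>(\<alpha> j - \<delta> * c) / \<epsilon>\<close> is the
        difference of the reciprocals of these two temperatures. The second is at most 1 because
        \<open>\<epsilon> \<le> \<delta> * \<alpha> K\<close>, so its normalizing constant is at
        most \<open>gibbs_Z \<gamma> I 1\<close>.\<close>
      have pos: "0 < \<epsilon> / \<alpha> j" "0 < \<epsilon> / (\<delta> * c)" using \<epsilon> \<alpha>pos[OF j] \<delta> c0 by simp_all
      have "(\<integral>\<^sup>+y. h j y \<partial>\<mu> (\<epsilon> / \<alpha> j)) = gibbs_Z \<gamma> I (\<epsilon> / (\<delta> * c)) / gibbs_Z \<gamma> I (\<epsilon> / \<alpha> j)"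
        using nn_integral_exp_\<mu>[OF pos] \<epsilon> by (simp add: h_def diff_divide_distrib left_diff_distrib)
      also have "\<dots> \<le> gibbs_Z \<gamma> I 1 / gibbs_Z \<gamma> I (\<epsilon> / \<alpha> j)"
        using pos \<epsilon> \<delta> c0 by (intro divide_right_mono_ennreal gibbs_Z_mono) (auto simp: c_def)
      also have "\<dots> \<le> gibbs_Z \<gamma> I 1 / ennreal (g * exp (- (\<eta> / (\<epsilon> / \<alpha> j))))"
        using g(1) Z(2) pos by (intro ennreal_divide_left_mono g(2)) auto
      also have "\<dots> = ennreal (z / g * exp (\<eta> * \<alpha> j / \<epsilon>))"
        using z g by (simp add: divide_ennreal exp_minus field_simps)
      also have "\<dots> \<le> ennreal (z / g * exp (\<eta> / \<epsilon>))"
        using z g \<epsilon> \<eta> W(4)[of j] j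
        by (intro ennreal_leI mult_left_mono) (auto intro!: divide_right_mono)
      finally show ?thesis .
    qed
    have AE_fin: "AE \<omega> in P. \<forall>j\<in>{1..K}. I (X j \<omega>) < \<infinity>"
      by (rule AE_sample_finite[OF \<epsilon>(1) \<alpha>pos S])
    have "ennreal (\<integral>\<omega>. ?est \<omega> \<partial>P) = (\<integral>\<^sup>+\<omega>. ennreal (?est \<omega>) \<partial>P)"
      by (rule nn_integral_eq_integral[symmetric, OF integrable_INS_estimator_sq[OF S K A]]) simp
    also have "\<dots> \<le> (\<integral>\<^sup>+\<omega>. ennreal D * (\<Prod>j=1..K. h j (X j \<omega>)) \<partial>P)"
    proof (rule nn_integral_mono_AE)
      show "AE \<omega> in P. ennreal (?est \<omega>) \<le> ennreal D * (\<Prod>j=1..K. h j (X j \<omega>))"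
        using AE_fin
      proof eventually_elim
        case (elim \<omega>)
        have "?est \<omega> \<le> D * (\<Prod>j=1..K. exp ((\<alpha> j - \<delta> * c) * enn2real (I (X j \<omega>)) / \<epsilon>))"
          unfolding D_def using elim \<delta> c by (intro INS_estimator_sq_le[OF \<epsilon>(1) \<alpha> K] a) auto
        then have "ennreal (?est \<omega>) \<le> ennreal (D * (\<Prod>j=1..K. exp ((\<alpha> j - \<delta> * c) * enn2real (I (X j \<omega>)) / \<epsilon>)))"
          by (rule ennreal_leI)
        also have "\<dots> = ennreal D * (\<Prod>j=1..K. h j (X j \<omega>))"
          unfolding h_def by (subst prod_ennreal) (auto intro!: ennreal_mult prod_nonneg simp: D_def)
        finally show ?case .
      qed
    qed
    also have "\<dots> = ennreal D * (\<integral>\<^sup>+\<omega>. (\<Prod>j=1..K. h j (X j \<omega>)) \<partial>P)"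
      by (intro nn_integral_cmult borel_measurable_prod_ennreal
          measurable_compose[OF sample_measurable[OF S] h_meas])
    also have "\<dots> = ennreal D * (\<Prod>j=1..K. \<integral>\<^sup>+y. h j y \<partial>\<mu> (\<epsilon> / \<alpha> j))"
      by (subst nn_integral_sample_prod[OF S h_meas]) simp
    also have "\<dots> \<le> ennreal D * (\<Prod>j=1..K. ennreal (z / g * exp (\<eta> / \<epsilon>)))"
      by (intro mult_left_mono prod_mono_ennreal factor) auto
    also have "\<dots> = ennreal (D * (z / g * exp (\<eta> / \<epsilon>)) ^ K)"
      using z g by (simp add: ennreal_power ennreal_mult D_def)
    finally have "(\<integral>\<omega>. ?est \<omega> \<partial>P) \<le> D * (z / g * exp (\<eta> / \<epsilon>)) ^ K"
      using z g by (subst (asm) ennreal_le_iff) (auto simp: D_def)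
    also have "\<dots> = C * (exp (- ((1 - \<delta>) * INS_V K \<alpha> * a / \<epsilon>)) * exp (K * (\<eta> / \<epsilon>)))"
      unfolding D_def C_def power_mult_distrib exp_of_nat_mult by (simp add: mult_ac)
    also have "exp (- ((1 - \<delta>) * INS_V K \<alpha> * a / \<epsilon>)) * exp (K * (\<eta> / \<epsilon>))
      = exp (- (((1 - \<delta>) * (INS_V K \<alpha> * a) - K * \<eta>) / \<epsilon>))"
      by (simp add: exp_add[symmetric] diff_divide_distrib mult.assoc)
    finally show ?thesis .
  qed
  have "0 < C" using z g by (simp add: C_def)
  then show thesis by (rule that[OF _ bound])
qed

text \<open>
  The sample is forced into regions where the energies are close to \<open>a\<close> times an optimal step vector
  \<open>v\<close>, in the order \<open>\<tau>\<close> that makes this cheapest; the summand \<open>\<sigma> = \<tau>\<^sup>-\<^sup>1\<close> of the estimator undoes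
  the reordering.
\<close>
lemma second_moment_lower:
  fixes a \<eta> :: real
  assumes \<alpha>: "INS_weights K \<alpha>" and \<alpha>pos: "\<And>j. j \<in> {1..K} \<Longrightarrow> 0 < \<alpha> j" and K: "1 \<le> K"
    and A: "A = closure (interior A)" and a: "(INF x\<in>A. I x) = ennreal a" "0 \<le> a"
    and \<eta>: "0 < \<eta>"
  obtains C where "0 < C"
    "\<And>\<epsilon> (P :: 'b measure) X. 0 < \<epsilon> \<Longrightarrow> \<epsilon> \<le> \<alpha> K \<Longrightarrow> INS_sample \<mu> K \<alpha> \<epsilon> P X \<Longrightarrow>
      C * exp (- ((INS_V K \<alpha> * a + 3 * real K * \<eta>) / \<epsilon>))
        \<le> (\<integral>\<omega>. (INS_estimator I A K \<alpha> \<epsilon> (\<lambda>j. X j \<omega>))\<^sup>2 \<partial>P)"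
proof -
  note W = INS_weightsD[OF \<alpha>]
  have Ab: "A \<in> sets borel" using A closed_closure by (metis borel_closed)
  \<comment> \<open>Open regions for the two entries of a step vector: energies near
    \<open>a\<close> inside the interior of \<open>A\<close> for entry 1, energies near 0 for entry
    0.\<close>
  define G where "G v = (if v = (1::real) then interior A \<inter> {x. I x < ennreal (a + \<eta>)} else {x. I x < ennreal \<eta>})" for v
  have G_open: "open (G v)" for v using open_sublevel by (simp add: G_def open_Int)
  have lo: "ennreal (a * v) \<le> I y" and hi: "I y < ennreal (a * v + \<eta>)" if "y \<in> G v" "v = 0 \<or> v = 1" for v y
  proof -
    have "ennreal a \<le> I y" if "y \<in> interior A"
      unfolding a(1)[symmetric] using that interior_subset by (intro INF_lower) auto
    then show "ennreal (a * v) \<le> I y" and "I y < ennreal (a * v + \<eta>)"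
      using that by (auto simp: G_def)
  qed
  have "\<exists>x. x \<in> G v" for v
  proof (cases "v = 1")
    case True
    have "(INF x\<in>A. I x) < ennreal (a + \<eta>)" using a \<eta> by (simp add: ennreal_lessI)
    then obtain y where y: "y \<in> A" "I y < ennreal (a + \<eta>)" by (auto simp: INF_less_iff)
    \<comment> \<open>A near-minimizer in \<open>A\<close> may lie on the boundary; an open set
      meeting the closure of the interior meets the interior itself.\<close>
    then have "{x. I x < ennreal (a + \<eta>)} \<inter> closure (interior A) \<noteq> {}" using A by auto
    then have "{x. I x < ennreal (a + \<eta>)} \<inter> interior A \<noteq> {}"
      using open_Int_closure_eq_empty[OF open_sublevel] by blast
    then show ?thesis using True by (auto simp: G_def)
  next
    case False
    then show ?thesis using ex_I_less[of "ennreal \<eta>"] \<eta> by (auto simp: G_def)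
  qed
  then have "\<exists>g>0. \<forall>\<epsilon>. 0 < \<epsilon> \<longrightarrow> \<epsilon> \<le> 1 \<longrightarrow> g * exp (- ((a * v + \<eta>) / \<epsilon>)) \<le> measure (\<mu> \<epsilon>) (G v)"
    if v: "v = 0 \<or> v = 1" for v
  proof -
    obtain x where x: "x \<in> G v" using \<open>\<And>v. \<exists>x. x \<in> G v\<close> by blast
    have "0 \<le> a * v + \<eta>" using v a \<eta> by auto
    then show ?thesis
      using emeasure_\<mu>_ge[OF G_open x, of "a * v + \<eta>"] hi[OF _ v] x
      by (metis ennreal_less_top less_trans order.strict_implies_order infinity_ennreal_def)
  qed
  from this[of 0] this[of 1] obtain g0 g1 where g01: "0 < g0" "0 < g1"
    "\<And>\<epsilon>. 0 < \<epsilon> \<Longrightarrow> \<epsilon> \<le> 1 \<Longrightarrow> g0 * exp (- ((a * 0 + \<eta>) / \<epsilon>)) \<le> measure (\<mu> \<epsilon>) (G 0)"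
    "\<And>\<epsilon>. 0 < \<epsilon> \<Longrightarrow> \<epsilon> \<le> 1 \<Longrightarrow> g1 * exp (- ((a * 1 + \<eta>) / \<epsilon>)) \<le> measure (\<mu> \<epsilon>) (G 1)"
    by blast
  define g where "g = min g0 g1"
  have g: "0 < g" using g01 by (simp add: g_def)
  have G_ge: "g * exp (- ((a * v + \<eta>) / \<epsilon>)) \<le> measure (\<mu> \<epsilon>) (G v)"
    if "0 < \<epsilon>" "\<epsilon> \<le> 1" "v = 0 \<or> v = 1" for v \<epsilon>
  proof -
    have "g * exp t \<le> g0 * exp t" "g * exp t \<le> g1 * exp t" for t
      by (simp_all add: g_def)
    then show ?thesis using g01(3,4)[OF that(1,2)] that(3) order_trans by blast
  qed
  obtain m where m: "m \<in> {1..K}"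
    and V: "2 * (\<Sum>j=1..K. \<alpha> j * step_vector m j) - least_energy K \<alpha> (step_vector m) \<le> INS_V K \<alpha>"
    using INS_V_attained[OF \<alpha> K] .
  define v where "v = step_vector m"
  define M where "M = least_energy K \<alpha> v"
  define N where "N = (\<Sum>j=1..K. \<alpha> j * v j)"
  have v01: "v j = 0 \<or> v j = 1" for j by (simp add: v_def step_vector_def)
  obtain \<tau> where \<tau>: "\<tau> permutes {1..K}" and M\<tau>: "M = (\<Sum>j=1..K. \<alpha> j * v (\<tau> j))"
    unfolding M_def using least_energy_attained .
  define \<sigma> where "\<sigma> = inv \<tau>"
  have \<sigma>: "\<sigma> permutes {1..K}" "\<And>j. \<tau> (\<sigma> j) = j"
    using permutes_inv[OF \<tau>] permutes_inverses[OF \<tau>] by (simp_all add: \<sigma>_def)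
  have \<alpha>1: "(\<Sum>j=1..K. \<alpha> j * \<eta>) \<le> K * \<eta>"
  proof -
    have "(\<Sum>j=1..K. \<alpha> j * \<eta>) \<le> (\<Sum>j=1..K. 1 * \<eta>)"
      using W(4) \<eta> by (intro sum_mono mult_right_mono) auto
    then show ?thesis by simp
  qed
  define C where "C = g ^ K / (fact K)\<^sup>2"
  have bound: "C * exp (- ((INS_V K \<alpha> * a + 3 * real K * \<eta>) / \<epsilon>))
        \<le> (\<integral>\<omega>. (INS_estimator I A K \<alpha> \<epsilon> (\<lambda>j. X j \<omega>))\<^sup>2 \<partial>P)"
    if \<epsilon>: "0 < \<epsilon>" "\<epsilon> \<le> \<alpha> K" and S: "INS_sample \<mu> K \<alpha> \<epsilon> P X" for \<epsilon> and P :: "'b measure" and X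
  proof -
    interpret prob_space P using S by (simp add: INS_sample_def)
    note X = sample_measurable[OF S]
    let ?est = "\<lambda>\<omega>. INS_estimator I A K \<alpha> \<epsilon> (\<lambda>j. X j \<omega>)"
    define Ev where "Ev = (\<Inter>j\<in>{1..K}. X j -` G (v (\<tau> j)) \<inter> space P)"
    \<comment> \<open>On \<open>Ev\<close>, the summand \<sigma> has exponent at most
      \<open>a * N + K * \<eta>\<close> in its numerator, while the least energy is at least
      \<open>a * M\<close>. Energies exceed their targets only upwards, hence a single
      \<open>K * \<eta>\<close>.\<close>
    define b where "b = exp (- ((a * (N - M) + K * \<eta>) / \<epsilon>)) / fact K"
    have Ev_sets: "Ev \<in> sets P"
      unfolding Ev_def using K X G_open
      by (intro sets.finite_INT measurable_sets[OF X] borel_open) auto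
    have prob_ge: "g ^ K * exp (- ((a * M + K * \<eta>) / \<epsilon>)) \<le> prob Ev"
    proof -
      have "g ^ K * exp (- ((a * M + K * \<eta>) / \<epsilon>)) \<le> g ^ K * exp (- ((a * M + (\<Sum>j=1..K. \<alpha> j * \<eta>)) / \<epsilon>))"
        using g \<epsilon> \<alpha>1 by (intro mult_left_mono) (auto intro!: divide_right_mono)
      \<comment> \<open>Coordinate \<open>j\<close> has temperature
        \<open>\<epsilon> / \<alpha> j\<close>, so its cost is weighted by
        \<open>\<alpha> j\<close>; by the choice of \<tau> the total is \<open>a * M\<close> plus
        errors.\<close>
      also have "\<dots> = (\<Prod>j=1..K. g * exp (- ((a * v (\<tau> j) + \<eta>) / (\<epsilon> / \<alpha> j))))"
        unfolding M\<tau> prod.distrib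
        by (simp add: exp_sum[symmetric] sum_negf sum_divide_distrib[symmetric] sum.distrib
            sum_distrib_left algebra_simps)
      also have "\<dots> \<le> (\<Prod>j=1..K. prob (X j -` G (v (\<tau> j)) \<inter> space P))"
      proof (intro prod_mono conjI)
        fix j assume j: "j \<in> {1..K}"
        show "0 \<le> g * exp (- ((a * v (\<tau> j) + \<eta>) / (\<epsilon> / \<alpha> j)))" using g by simp
        have "\<alpha> K \<le> \<alpha> j" using W(2)[of j K] j by auto
        then have "0 < \<epsilon> / \<alpha> j" "\<epsilon> / \<alpha> j \<le> 1" using \<epsilon> \<alpha>pos[OF j] by auto
        then have "g * exp (- ((a * v (\<tau> j) + \<eta>) / (\<epsilon> / \<alpha> j))) \<le> measure (\<mu> (\<epsilon> / \<alpha> j)) (G (v (\<tau> j)))"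
          using v01 by (intro G_ge)
        also have "\<mu> (\<epsilon> / \<alpha> j) = distr P borel (X j)" using S j unfolding INS_sample_def by auto
        also have "measure (distr P borel (X j)) (G (v (\<tau> j))) = prob (X j -` G (v (\<tau> j)) \<inter> space P)"
          using G_open by (intro measure_distr X j borel_open)
        finally show "g * exp (- ((a * v (\<tau> j) + \<eta>) / (\<epsilon> / \<alpha> j))) \<le> prob (X j -` G (v (\<tau> j)) \<inter> space P)" .
      qed
      also have "\<dots> = prob Ev"
        unfolding Ev_def using S K G_open
        by (intro indep_varsD_finite[symmetric, where M'="\<lambda>_. borel"]) (auto simp: INS_sample_def)
      finally show ?thesis .
    qed
    have est_ge: "b \<le> ?est \<omega>" if \<omega>: "\<omega> \<in> Ev" for \<omega>
    proof -
      define u where "u j = enn2real (I (X j \<omega>))" for j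
      have XG: "X j \<omega> \<in> G (v (\<tau> j))" if "j \<in> {1..K}" for j using \<omega> that by (auto simp: Ev_def)
      have fin: "I (X j \<omega>) < \<infinity>" if "j \<in> {1..K}" for j
        using hi[OF XG[OF that] v01] by (simp add: less_trans[OF _ ennreal_less_top])
      have av: "0 \<le> a * v j" for j using a v01[of j] by auto
      have ul: "a * v (\<tau> j) \<le> u j" and uh: "u j \<le> a * v (\<tau> j) + \<eta>" if j: "j \<in> {1..K}" for j
      proof -
        obtain r where r: "0 \<le> r" "I (X j \<omega>) = ennreal r" using fin[OF j] by (cases "I (X j \<omega>)") auto
        show "a * v (\<tau> j) \<le> u j" "u j \<le> a * v (\<tau> j) + \<eta>"
          using lo[OF XG[OF j] v01] hi[OF XG[OF j] v01] r av[of "\<tau> j"]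
          by (auto simp: u_def ennreal_less_iff)
      qed
      have in\<sigma>: "\<pi> j \<in> {1..K}" if "\<pi> permutes {1..K}" "j \<in> {1..K}" for \<pi> j
        using permutes_in_image[OF that(1)] that(2) by blast
      have "(\<Sum>j=1..K. \<alpha> j * u (\<sigma> j)) \<le> (\<Sum>j=1..K. \<alpha> j * (a * v j + \<eta>))"
      proof (intro sum_mono mult_left_mono)
        fix j assume j: "j \<in> {1..K}"
        show "u (\<sigma> j) \<le> a * v j + \<eta>" using uh[OF in\<sigma>[OF \<sigma>(1) j]] \<sigma>(2) by simp
        show "0 \<le> \<alpha> j" using \<alpha>pos[OF j] by simp
      qed
      also have "\<dots> = a * N + (\<Sum>j=1..K. \<alpha> j * \<eta>)"
        by (simp add: N_def sum_distrib_left distrib_left sum.distrib mult_ac)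
      finally have 1: "(\<Sum>j=1..K. \<alpha> j * u (\<sigma> j)) \<le> a * N + K * \<eta>" using \<alpha>1 by simp
      have 2: "a * M \<le> least_energy K \<alpha> u"
      proof (rule least_energy_geI)
        fix \<pi> assume \<pi>: "\<pi> permutes {1..K}"
        have "M \<le> (\<Sum>j=1..K. \<alpha> j * v (\<tau> (\<pi> j)))"
          using least_energy_le[OF permutes_compose[OF \<pi> \<tau>], of \<alpha> v] by (simp add: M_def comp_def)
        then have "a * M \<le> a * (\<Sum>j=1..K. \<alpha> j * v (\<tau> (\<pi> j)))" using a by (intro mult_left_mono)
        also have "\<dots> = (\<Sum>j=1..K. \<alpha> j * (a * v (\<tau> (\<pi> j))))" by (simp add: sum_distrib_left mult_ac)
        also have "\<dots> \<le> (\<Sum>j=1..K. \<alpha> j * u (\<pi> j))"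
        proof (intro sum_mono mult_left_mono)
          fix j assume j: "j \<in> {1..K}"
          show "a * v (\<tau> (\<pi> j)) \<le> u (\<pi> j)" by (rule ul[OF in\<sigma>[OF \<pi> j]])
          show "0 \<le> \<alpha> j" using \<alpha>pos[OF j] by simp
        qed
        finally show "a * M \<le> (\<Sum>j=1..K. \<alpha> j * u (\<pi> j))" .
      qed
      have "v 1 = 1" by (simp add: v_def step_vector_def)
      then have "X (\<sigma> 1) \<omega> \<in> A"
        using XG[OF in\<sigma>[OF \<sigma>(1), of 1]] K \<sigma>(2)[of 1] interior_subset[of A] by (auto simp: G_def)
      from INS_estimator_ge[where I=I and x="\<lambda>j. X j \<omega>", OF \<epsilon>(1) \<alpha> fin \<sigma>(1) this]
      have "exp (- (((\<Sum>j=1..K. \<alpha> j * u (\<sigma> j)) - least_energy K \<alpha> u) / \<epsilon>)) / fact K \<le> ?est \<omega>"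
        by (simp add: u_def[abs_def])
      moreover have "b \<le> exp (- (((\<Sum>j=1..K. \<alpha> j * u (\<sigma> j)) - least_energy K \<alpha> u) / \<epsilon>)) / fact K"
        unfolding b_def using 1 2 \<epsilon>
        by (intro divide_right_mono) (auto simp: right_diff_distrib intro!: divide_right_mono)
      ultimately show ?thesis by simp
    qed
    have b0: "0 \<le> b" by (simp add: b_def)
    have "a * (2 * N - M) \<le> a * INS_V K \<alpha>"
      using V a by (intro mult_left_mono) (auto simp: N_def M_def v_def)
    \<comment> \<open>The squared estimator costs \<open>2 * a * (N - M)\<close> and the event
      \<open>a * M\<close>, together \<open>a * (2 * N - M)\<close>. Two of the three errors
      \<open>K * \<eta>\<close> come from the square, one from the probability.\<close>
    then have "2 * (a * (N - M) + K * \<eta>) + (a * M + K * \<eta>) \<le> INS_V K \<alpha> * a + 3 * real K * \<eta>"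
      by (simp add: algebra_simps)
    then have "exp (- ((INS_V K \<alpha> * a + 3 * real K * \<eta>) / \<epsilon>))
        \<le> exp (- ((2 * (a * (N - M) + K * \<eta>) + (a * M + K * \<eta>)) / \<epsilon>))"
      using \<epsilon> by (simp add: divide_right_mono)
    also have "\<dots> = (exp (- ((a * (N - M) + K * \<eta>) / \<epsilon>)))\<^sup>2 * exp (- ((a * M + K * \<eta>) / \<epsilon>))"
      by (simp add: power2_eq_square exp_add[symmetric] add_divide_distrib diff_divide_distrib)
    finally have "C * exp (- ((INS_V K \<alpha> * a + 3 * real K * \<eta>) / \<epsilon>))
        \<le> C * ((exp (- ((a * (N - M) + K * \<eta>) / \<epsilon>)))\<^sup>2 * exp (- ((a * M + K * \<eta>) / \<epsilon>)))"
      using g by (intro mult_left_mono) (auto simp: C_def)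
    also have "\<dots> = b\<^sup>2 * (g ^ K * exp (- ((a * M + K * \<eta>) / \<epsilon>)))"
      by (simp add: b_def C_def power_divide)
    also have "\<dots> \<le> b\<^sup>2 * prob Ev" by (intro mult_left_mono prob_ge) simp
    also have "\<dots> = (\<integral>\<omega>. b\<^sup>2 * indicator Ev \<omega> \<partial>P)" using Ev_sets by simp
    also have "\<dots> \<le> (\<integral>\<omega>. (?est \<omega>)\<^sup>2 \<partial>P)"
    proof (rule integral_mono)
      show "integrable P (\<lambda>\<omega>. b\<^sup>2 * indicator Ev \<omega>)"
        using Ev_sets by (intro integrable_mult_right integrable_real_indicator) (auto simp: emeasure_eq_measure)
      show "integrable P (\<lambda>\<omega>. (?est \<omega>)\<^sup>2)" by (rule integrable_INS_estimator_sq[OF S K Ab])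
      show "b\<^sup>2 * indicator Ev \<omega> \<le> (?est \<omega>)\<^sup>2" for \<omega>
        using est_ge[of \<omega>] b0 by (auto simp: indicator_def intro: power_mono)
    qed
    finally show ?thesis .
  qed
  have "0 < C" using g by (simp add: C_def)
  then show thesis by (rule that[OF _ bound])
qed

text \<open>Almost surely all energies are finite, whereas \<open>A\<close> contains no point of
  finite energy; the empty set is included.\<close>

lemma second_moment_infinite:
  assumes \<epsilon>: "0 < \<epsilon>" and \<alpha>pos: "\<And>j. j \<in> {1..K} \<Longrightarrow> 0 < \<alpha> j" and K: "1 \<le> K"
    and a: "(INF x\<in>A. I x) = \<infinity>" and S: "INS_sample \<mu> K \<alpha> \<epsilon> P X"
  shows "(\<integral>\<omega>. (INS_estimator I A K \<alpha> \<epsilon> (\<lambda>j. X j \<omega>))\<^sup>2 \<partial>P) = 0"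
proof (rule integral_eq_zero_AE)
  have AE_fin: "AE \<omega> in P. \<forall>j\<in>{1..K}. I (X j \<omega>) < \<infinity>"
    by (rule AE_sample_finite[OF \<epsilon> \<alpha>pos S])
  show "AE \<omega> in P. (INS_estimator I A K \<alpha> \<epsilon> (\<lambda>j. X j \<omega>))\<^sup>2 = 0"
    using AE_fin
  proof eventually_elim
    case (elim \<omega>)
    have "X (\<sigma> 1) \<omega> \<notin> A" if "\<sigma> permutes {1..K}" for \<sigma>
    proof
      assume "X (\<sigma> 1) \<omega> \<in> A"
      then have "(INF x\<in>A. I x) \<le> I (X (\<sigma> 1) \<omega>)" by (rule INF_lower)
      then have "I (X (\<sigma> 1) \<omega>) = \<infinity>" using a by (simp add: top_unique)
      moreover have "\<sigma> 1 \<in> {1..K}" using permutes_in_image[OF that, of 1] K by simp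
      ultimately show False using bspec[OF elim] by force
    qed
    then have "INS_estimator I A K \<alpha> \<epsilon> (\<lambda>j. X j \<omega>) \<le> fact K * 0"
      by (intro INS_estimator_leI) auto
    then show ?case using INS_estimator_nonneg[of I A K \<alpha> \<epsilon> "\<lambda>j. X j \<omega>"] by simp
  qed
qed

lemma second_moment_tendsto:
  fixes P :: "real \<Rightarrow> 'b measure" and X :: "real \<Rightarrow> nat \<Rightarrow> 'b \<Rightarrow> 'a"
  assumes \<alpha>: "INS_weights K \<alpha>" and \<alpha>pos: "\<And>j. j \<in> {1..K} \<Longrightarrow> 0 < \<alpha> j" and K: "1 \<le> K"
    and A: "A = closure (interior A)"
    and S: "\<And>\<epsilon>. 0 < \<epsilon> \<Longrightarrow> INS_sample \<mu> K \<alpha> \<epsilon> (P \<epsilon>) (X \<epsilon>)"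
  shows "((\<lambda>\<epsilon>. - (ereal \<epsilon> * elog (\<integral>\<omega>. (INS_estimator I A K \<alpha> \<epsilon> (\<lambda>j. X \<epsilon> j \<omega>))\<^sup>2 \<partial>P \<epsilon>)))
    \<longlongrightarrow> ereal (INS_V K \<alpha>) * enn2ereal (INF x\<in>A. I x)) (at_right 0)"
proof (cases "INF x\<in>A. I x")
  case top
  have "0 < INS_V K \<alpha>" using INS_V_ge_1[OF \<alpha> K] by simp
  then have "ereal (INS_V K \<alpha>) * enn2ereal (INF x\<in>A. I x) = \<infinity>"
    using top by (simp add: top_ereal_def)
  moreover have "\<forall>\<^sub>F \<epsilon> in at_right 0. \<infinity> = - (ereal \<epsilon> * elog (\<integral>\<omega>. (INS_estimator I A K \<alpha> \<epsilon> (\<lambda>j. X \<epsilon> j \<omega>))\<^sup>2 \<partial>P \<epsilon>))"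
  proof (rule eventually_mono[OF eventually_at_right_less])
    fix \<epsilon> :: real assume "0 < \<epsilon>"
    then show "\<infinity> = - (ereal \<epsilon> * elog (\<integral>\<omega>. (INS_estimator I A K \<alpha> \<epsilon> (\<lambda>j. X \<epsilon> j \<omega>))\<^sup>2 \<partial>P \<epsilon>))"
      using second_moment_infinite[OF _ \<alpha>pos K _ S, of \<epsilon> A] top by (simp add: elog_def)
  qed
  ultimately show ?thesis by (auto intro: Lim_transform_eventually[OF tendsto_const])
next
  case (real a)
  define V where "V = INS_V K \<alpha>"
  have V: "1 \<le> V" using INS_V_ge_1[OF \<alpha> K] by (simp add: V_def)
  have Ab: "A \<in> sets borel" using A closed_closure by (metis borel_closed)
  have Va: "0 \<le> V * a" using V real by simp
  have aK: "0 < \<alpha> K" using \<alpha>pos[of K] K by simp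
  have small: "\<forall>\<^sub>F \<epsilon> in at_right (0::real). 0 < \<epsilon> \<and> \<epsilon> \<le> r" if "0 < r" for r
    using that by (auto simp: eventually_at_right intro!: exI[of _ r])
  have "((\<lambda>\<epsilon>. - (ereal \<epsilon> * elog (\<integral>\<omega>. (INS_estimator I A K \<alpha> \<epsilon> (\<lambda>j. X \<epsilon> j \<omega>))\<^sup>2 \<partial>P \<epsilon>)))
    \<longlongrightarrow> ereal (V * a)) (at_right 0)"
  proof (rule tendsto_minus_elog)
    fix \<kappa> :: real assume \<kappa>: "0 < \<kappa>"
    \<comment> \<open>The loss \<kappa> is split evenly: \<open>\<delta> * (V * a)\<close> is at
      most \<open>\<kappa> / 2\<close>, and \<eta> is chosen so that \<open>K * \<eta>\<close>
      equals \<open>\<kappa> / 2\<close>. The summand 1 keeps the denominator positive when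
      \<open>a = 0\<close>.\<close>
    define \<delta> where "\<delta> = min 1 (\<kappa> / (2 * (V * a + 1)))"
    define \<eta> where "\<eta> = \<kappa> / (2 * K)"
    have \<delta>: "0 < \<delta>" "\<delta> \<le> 1" using \<kappa> Va by (auto simp: \<delta>_def)
    have \<eta>: "0 < \<eta>" using \<kappa> K by (simp add: \<eta>_def)
    have "\<delta> * (V * a) \<le> \<kappa> / (2 * (V * a + 1)) * (V * a)"
      using Va by (intro mult_right_mono) (auto simp: \<delta>_def)
    also have "\<dots> \<le> \<kappa> / 2" using Va \<kappa> by (simp add: field_simps)
    finally have exponent: "V * a - \<kappa> \<le> (1 - \<delta>) * (V * a) - K * \<eta>"
      using K by (simp add: \<eta>_def left_diff_distrib)
    have a_le: "ennreal a \<le> I y" if "y \<in> A" for y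
      unfolding real(2)[symmetric] using that by (rule INF_lower)
    \<comment> \<open>Uniformity over probability spaces and samples matters here, since both
      \<open>P \<epsilon>\<close> and \<open>X \<epsilon>\<close> vary with \<epsilon>.\<close>
    obtain C where C0: "0 < C" and C': "\<And>\<epsilon> (P :: 'b measure) X. 0 < \<epsilon> \<Longrightarrow> \<epsilon> \<le> \<delta> * \<alpha> K \<Longrightarrow>
      INS_sample \<mu> K \<alpha> \<epsilon> P X \<Longrightarrow> (\<integral>\<omega>. (INS_estimator I A K \<alpha> \<epsilon> (\<lambda>j. X j \<omega>))\<^sup>2 \<partial>P)
        \<le> C * exp (- (((1 - \<delta>) * (V * a) - K * \<eta>) / \<epsilon>))"
      using second_moment_upper[OF \<alpha> \<alpha>pos K Ab a_le \<delta> \<eta>, where 'b='b] unfolding V_def by metis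
    note C = C0 C'[OF _ _ S]
    show "\<exists>C>0. \<forall>\<^sub>F \<epsilon> in at_right 0. (\<integral>\<omega>. (INS_estimator I A K \<alpha> \<epsilon> (\<lambda>j. X \<epsilon> j \<omega>))\<^sup>2 \<partial>P \<epsilon>)
      \<le> C * exp (- ((V * a - \<kappa>) / \<epsilon>))"
    proof (intro exI[of _ C] conjI C)
      have "0 < \<delta> * \<alpha> K" using \<delta> aK by simp
      from small[OF this] show "\<forall>\<^sub>F \<epsilon> in at_right 0. (\<integral>\<omega>. (INS_estimator I A K \<alpha> \<epsilon> (\<lambda>j. X \<epsilon> j \<omega>))\<^sup>2 \<partial>P \<epsilon>)
        \<le> C * exp (- ((V * a - \<kappa>) / \<epsilon>))"
      proof eventually_elim
        case (elim \<epsilon>)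
        have "C * exp (- (((1 - \<delta>) * (V * a) - K * \<eta>) / \<epsilon>)) \<le> C * exp (- ((V * a - \<kappa>) / \<epsilon>))"
          using C(1) exponent elim by (simp add: divide_right_mono)
        then show ?case using C(2)[of \<epsilon>] elim by linarith
      qed
    qed
  next
    fix \<kappa> :: real assume \<kappa>: "0 < \<kappa>"
    define \<eta> where "\<eta> = \<kappa> / (3 * K)"
    have \<eta>: "0 < \<eta>" "3 * real K * \<eta> = \<kappa>" using \<kappa> K by (simp_all add: \<eta>_def)
    obtain C where C0: "0 < C" and C': "\<And>\<epsilon> (P :: 'b measure) X. 0 < \<epsilon> \<Longrightarrow> \<epsilon> \<le> \<alpha> K \<Longrightarrow>
      INS_sample \<mu> K \<alpha> \<epsilon> P X \<Longrightarrow> C * exp (- ((V * a + 3 * real K * \<eta>) / \<epsilon>))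
        \<le> (\<integral>\<omega>. (INS_estimator I A K \<alpha> \<epsilon> (\<lambda>j. X j \<omega>))\<^sup>2 \<partial>P)"
      using second_moment_lower[OF \<alpha> \<alpha>pos K A real(2,1) \<eta>(1), where 'b='b] unfolding V_def by metis
    note C = C0 C'[OF _ _ S]
    show "\<exists>C>0. \<forall>\<^sub>F \<epsilon> in at_right 0. C * exp (- ((V * a + \<kappa>) / \<epsilon>))
      \<le> (\<integral>\<omega>. (INS_estimator I A K \<alpha> \<epsilon> (\<lambda>j. X \<epsilon> j \<omega>))\<^sup>2 \<partial>P \<epsilon>)"
      using C \<eta>(2) small[OF aK] by (auto intro!: exI[of _ C] elim: eventually_mono)
  qed
  moreover have "ereal V * enn2ereal (INF x\<in>A. I x) = ereal (V * a)"
    using real by (simp add: enn2ereal_ennreal)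
  ultimately show ?thesis by (simp add: V_def)
qed

end

theorem theorem3p11:
  fixes \<gamma> :: "'a::polish_space measure"
    and I :: "'a \<Rightarrow> ennreal"
    and \<mu> :: "real \<Rightarrow> 'a measure"
    and A :: "'a set"
  assumes "sets \<gamma> = sets borel"
    and "rate_function I"
    and "\<forall>x. I x < \<infinity> \<longrightarrow> isCont I x"
    and "\<forall>\<epsilon>>0. 0 < gibbs_Z \<gamma> I \<epsilon> \<and> gibbs_Z \<gamma> I \<epsilon> < \<infinity>"
    and "\<forall>\<epsilon>>0. prob_space (\<mu> \<epsilon>) \<and> \<mu> \<epsilon> = gibbs_measure \<gamma> I \<epsilon>"
    and "satisfies_LDP \<mu> I"
    and "A = closure (interior A)"
  shows "\<forall>K\<ge>1.
    (\<forall>\<alpha> (P :: real \<Rightarrow> 'b measure) (X :: real \<Rightarrow> nat \<Rightarrow> 'b \<Rightarrow> 'a).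
       INS_weights K \<alpha> \<longrightarrow> (\<forall>j\<in>{1..K}. 0 < \<alpha> j) \<longrightarrow>
       (\<forall>\<epsilon>>0. INS_sample \<mu> K \<alpha> \<epsilon> (P \<epsilon>) (X \<epsilon>)) \<longrightarrow>
       ((\<lambda>\<epsilon>. - (ereal \<epsilon> *
            elog (\<integral>\<omega>. (INS_estimator I A K \<alpha> \<epsilon> (\<lambda>j. X \<epsilon> j \<omega>))\<^sup>2 \<partial>P \<epsilon>)))
         \<longlongrightarrow> ereal (INS_V K \<alpha>) * enn2ereal (INF x\<in>A. I x)) (at_right 0)) \<and>
    is_arg_max (INS_V K) (INS_weights K) (\<lambda>j. (1/2) ^ (j - 1)) \<and>
    INS_V K (\<lambda>j. (1/2) ^ (j - 1)) = 2 - (1/2) ^ (K - 1)"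
proof -
  interpret gibbs_ldp \<gamma> I \<mu>
    by (rule gibbs_ldp.intro) (use assms in blast)+
  show ?thesis
  proof (intro allI impI conjI)
    fix K :: nat and \<alpha> :: "nat \<Rightarrow> real" and P :: "real \<Rightarrow> 'b measure" and X
    assume "1 \<le> K" "INS_weights K \<alpha>" "\<forall>j\<in>{1..K}. 0 < \<alpha> j" "\<forall>\<epsilon>>0. INS_sample \<mu> K \<alpha> \<epsilon> (P \<epsilon>) (X \<epsilon>)"
    then show "((\<lambda>\<epsilon>. - (ereal \<epsilon> *
            elog (\<integral>\<omega>. (INS_estimator I A K \<alpha> \<epsilon> (\<lambda>j. X \<epsilon> j \<omega>))\<^sup>2 \<partial>P \<epsilon>)))
         \<longlongrightarrow> ereal (INS_V K \<alpha>) * enn2ereal (INF x\<in>A. I x)) (at_right 0)"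
      using assms(7) by (intro second_moment_tendsto) blast+
  next
    fix K :: nat
    assume K: "1 \<le> K"
    show V: "INS_V K (\<lambda>j. (1/2) ^ (j - 1)) = 2 - (1/2) ^ (K - 1)" by (rule INS_V_geometric[OF K])
    show "is_arg_max (INS_V K) (INS_weights K) (\<lambda>j. (1/2) ^ (j - 1))"
      unfolding is_arg_max_def V using INS_weights_geometric INS_V_le[OF _ K] by (auto simp: not_less)
  qed
qed

end
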